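(* Let $n\ge2$. For any $c\in W_{A_{2n}^{\prime(2)}}^0=\mathcal C_{2n}^s$, we have $$L_{A_{2n}^{\prime(2)}}(c)=L(c)+a_n(c).$$
   Context: A $2n$-core is a partition having no hook length equal to $2n$; $\mathcal C_{2n}$ is the set of $2n$-cores and $\mathcal C_{2n}^s$ the subset of self-conjugate ones. The box in row $i$, column $j$ has residue $(j-i)\bmod 2n$; boxes of residue $i$ are $i$-nodes. The affine Weyl group $\widetilde{\mathfrak S}_{2n}$ of type $A_{2n-1}^{(1)}$, with simple reflections $s_0,\dots,s_{2n-1}$, acts on $\mathcal C_{2n}$: $s_i\cdot c$ is obtained by removing all removable $i$-nodes of $c$ if there are some, adding all addable $i$-nodes if there are some, and $s_i\cdot c=c$ otherwise. $L(c)$ denotes the number of boxes of $c$ and $a_i(c)$ the number of boxes of $c$ of residue $i$. Let $\alpha_0,\dots,\alpha_{2n-1}$ and $\Lambda_0,\dots,\Lambda_{2n-1}$ be the simple roots and fundamental weights of the affine root system of type $A_{2n-1}^{(1)}$, on which $\widetilde{\mathfrak S}_{2n}$ acts by $s_i(x)=x-\langle x,\alpha_i^\vee\rangle\alpha_i$. $A_{2n}^{\prime(2)}$ denotes the affine root system obtained by transposing the Cartan matrix of type $A_{2n}^{(2)}$; it is realized by $\alpha_0^{A_{2n}^{\prime(2)}}=2\alpha_0$, $\alpha_i^{A_{2n}^{\prime(2)}}=\alpha_i+\alpha_{2n-i}$ ($1\le i\le n-1$), $\alpha_n^{A_{2n}^{\prime(2)}}=\alpha_n$, $\Lambda_0^{A_{2n}^{\prime(2)}}=2\Lambda_0$,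 and its Weyl group $W_{A_{2n}^{\prime(2)}}$ as the subgroup of $\widetilde{\mathfrak S}_{2n}$ generated by $s_0$, $s_is_{2n-i}$ ($1\le i\le n-1$), $s_n$. The affine Grassmannian $W_{A_{2n}^{\prime(2)}}^0$ (minimal length representatives of left cosets modulo the finite Weyl group generated by all these generators except $s_0$) is identified with $\mathcal C_{2n}^s$ via $w\mapsto w\cdot\varnothing$. The atomic length: for $w\in W_{A_{2n}^{\prime(2)}}^0$ with $c=w\cdot\varnothing$, write $\Lambda_0^{A_{2n}^{\prime(2)}}-w(\Lambda_0^{A_{2n}^{\prime(2)}})=\sum_{i=0}^n a_i^{A_{2n}^{\prime(2)}}(c)\,\alpha_i^{A_{2n}^{\prime(2)}}$; then $L_{A_{2n}^{\prime(2)}}(c)=\sum_{i=0}^n a_i^{A_{2n}^{\prime(2)}}(c)$. *)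

theory Defs
  imports Complex_Main "HOL-Algebra.Bij" "HOL-Algebra.Generated_Groups"
begin

section \<open>Partitions, cores and the simple reflections on them\<close>

text \<open>
  A partition is identified with its Young diagram, the finite set of its boxes (row, column).
  Rows and columns are numbered from 0, which does not affect the residues \<open>(j - i) mod e\<close>.
\<close>

type_synonym box = "nat \<times> nat"

definition is_partition :: "box set \<Rightarrow> bool" where
  "is_partition c \<longleftrightarrow> finite c \<and>
     (\<forall>i j i' j'. (i, j) \<in> c \<longrightarrow> i' \<le> i \<longrightarrow> j' \<le> j \<longrightarrow> (i', j') \<in> c)"

definition conjugate :: "box set \<Rightarrow> box set" where
  "conjugate c = prod.swap ` c"

definition hook_length :: "box set \<Rightarrow> box \<Rightarrow> nat" where
  "hook_length c = (\<lambda>(i, j). card {j'. j < j' \<and> (i, j') \<in> c} + card {i'. i < i' \<and> (i', j) \<in> c} + 1)"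

definition cores :: "nat \<Rightarrow> box set set" where
  "cores e = {c. is_partition c \<and> (\<forall>b\<in>c. hook_length c b \<noteq> e)}"

definition sc_cores :: "nat \<Rightarrow> box set set" where
  "sc_cores e = {c \<in> cores e. conjugate c = c}"

definition box_residue :: "nat \<Rightarrow> box \<Rightarrow> nat" where
  "box_residue e = (\<lambda>(i, j). nat ((int j - int i) mod int e))"

definition residue_count :: "nat \<Rightarrow> nat \<Rightarrow> box set \<Rightarrow> nat" where
  "residue_count e i c = card {b \<in> c. box_residue e b = i}"

definition removable_nodes :: "nat \<Rightarrow> nat \<Rightarrow> box set \<Rightarrow> box set" where
  "removable_nodes e i c = {b. b \<in> c \<and> is_partition (c - {b}) \<and> box_residue e b = i}"

definition addable_nodes :: "nat \<Rightarrow> nat \<Rightarrow> box set \<Rightarrow> box set" where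
  "addable_nodes e i c = {b. b \<notin> c \<and> is_partition (insert b c) \<and> box_residue e b = i}"

definition core_refl :: "nat \<Rightarrow> nat \<Rightarrow> box set \<Rightarrow> box set" where
  "core_refl e i c =
     (if removable_nodes e i c \<noteq> {} then c - removable_nodes e i c
      else if addable_nodes e i c \<noteq> {} then c \<union> addable_nodes e i c
      else c)"


section \<open>The affine root system of type \<open>A\<^sub>e\<^sub>-\<^sub>1\<^sup>(\<^sup>1\<^sup>)\<close> and its Weyl group\<close>

text \<open>
  A weight \<open>x\<close> is given by its values on the basis \<open>\<alpha>\<^sub>0\<^sup>\<or>, \<dots>, \<alpha>\<^sub>e\<^sub>-\<^sub>1\<^sup>\<or>, d\<close> of the Cartan subalgebra
  (\<open>d\<close> the scaling element): \<open>x k\<close> is the pairing with the \<open>k\<close>-th simple coroot if \<open>k < e\<close>, and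
  \<open>x e\<close> is the pairing with \<open>d\<close>.  Equivalently, these are the coordinates of \<open>x\<close> with respect to
  \<open>\<Lambda>\<^sub>0, \<dots>, \<Lambda>\<^sub>e\<^sub>-\<^sub>1, \<delta>\<close>.  Weights in the strict sense vanish at all \<open>k > e\<close>; the reflections do
  not change these further coordinates.  The coordinate at \<open>d\<close> makes the simple roots linearly
  independent.
\<close>

type_synonym weight = "nat \<Rightarrow> real"

text \<open>The generalized Cartan matrix, for \<open>e \<ge> 3\<close>.\<close>

definition cartan :: "nat \<Rightarrow> nat \<Rightarrow> nat \<Rightarrow> real" where
  "cartan e i j =
     (if i = j then 2 else if (i + 1) mod e = j \<or> (j + 1) mod e = i then -1 else 0)"

definition simple_root :: "nat \<Rightarrow> nat \<Rightarrow> weight" where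
  "simple_root e i =
     (\<lambda>k. if k < e then cartan e k i else if k = e \<and> i = 0 then 1 else 0)"

definition fund_weight :: "nat \<Rightarrow> weight" where
  "fund_weight i = (\<lambda>k. if k = i then 1 else 0)"

definition weight_refl :: "nat \<Rightarrow> nat \<Rightarrow> weight \<Rightarrow> weight" where
  "weight_refl e i x = (\<lambda>k. x k - x i * simple_root e i k)"

text \<open>
  The Weyl groups are taken as groups of transformations of the weight space.
\<close>

abbreviation weight_perms :: "(weight \<Rightarrow> weight) monoid" where
  "weight_perms \<equiv> BijGroup UNIV"

definition affine_weyl :: "nat \<Rightarrow> (weight \<Rightarrow> weight) set" where
  "affine_weyl e = generate weight_perms (weight_refl e ` {..<e})"

text \<open>
  The action of \<open>affine_weyl e\<close> on \<open>cores e\<close> that extends \<open>core_refl\<close>: a group element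
  \<open>s\<^sub>i\<^sub>1 \<dots> s\<^sub>i\<^sub>k\<close> acts by the corresponding composition of the \<open>core_refl\<close>; the result does not depend
  on the chosen word.
\<close>

definition core_act :: "nat \<Rightarrow> (weight \<Rightarrow> weight) \<Rightarrow> box set \<Rightarrow> box set" where
  "core_act e w c =
     (THE d. \<exists>is. set is \<subseteq> {..<e} \<and> w = foldr (weight_refl e) is \<and> d = foldr (core_refl e) is c)"


section \<open>The root system of type \<open>A'\<^sub>2\<^sub>n\<^sup>(\<^sup>2\<^sup>)\<close>, realized inside type \<open>A\<^sub>2\<^sub>n\<^sub>-\<^sub>1\<^sup>(\<^sup>1\<^sup>)\<close>\<close>

definition tw_root :: "nat \<Rightarrow> nat \<Rightarrow> weight" where
  "tw_root n i =
     (if i = 0 then (\<lambda>k. 2 * simple_root (2 * n) 0 k)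
      else if i = n then simple_root (2 * n) n
      else (\<lambda>k. simple_root (2 * n) i k + simple_root (2 * n) (2 * n - i) k))"

definition tw_weight0 :: weight where
  "tw_weight0 = (\<lambda>k. 2 * fund_weight 0 k)"

definition tw_refl :: "nat \<Rightarrow> nat \<Rightarrow> weight \<Rightarrow> weight" where
  "tw_refl n i =
     (if i = 0 \<or> i = n then weight_refl (2 * n) i
      else weight_refl (2 * n) i \<circ> weight_refl (2 * n) (2 * n - i))"

definition tw_weyl :: "nat \<Rightarrow> (weight \<Rightarrow> weight) set" where
  "tw_weyl n = generate weight_perms (tw_refl n ` {0..n})"

definition tw_fin_weyl :: "nat \<Rightarrow> (weight \<Rightarrow> weight) set" where
  "tw_fin_weyl n = generate weight_perms (tw_refl n ` {1..n})"

definition tw_length :: "nat \<Rightarrow> (weight \<Rightarrow> weight) \<Rightarrow> nat" where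
  "tw_length n w =
     (LEAST k. \<exists>ws. length ws = k \<and> set ws \<subseteq> {0..n} \<and> w = foldr (tw_refl n) ws)"

definition tw_grassmannian :: "nat \<Rightarrow> (weight \<Rightarrow> weight) set" where
  "tw_grassmannian n =
     {w \<in> tw_weyl n. \<forall>v \<in> w <#\<^bsub>weight_perms\<^esub> tw_fin_weyl n. tw_length n w \<le> tw_length n v}"

text \<open>
  The inverse of the identification \<open>w \<mapsto> w \<cdot> \<emptyset>\<close> of \<open>tw_grassmannian n\<close> with \<open>sc_cores (2 * n)\<close>.
\<close>

definition grassmannian_of :: "nat \<Rightarrow> box set \<Rightarrow> (weight \<Rightarrow> weight)" where
  "grassmannian_of n = inv_into (tw_grassmannian n) (\<lambda>w. core_act (2 * n) w {})"

text \<open>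
  The coefficients of \<open>\<Lambda>\<^sub>0 - w(\<Lambda>\<^sub>0)\<close> in the (linearly independent) simple roots of the twisted
  system, extended by 0 to all indices.
\<close>

definition tw_coeff :: "nat \<Rightarrow> box set \<Rightarrow> nat \<Rightarrow> real" where
  "tw_coeff n c =
     (THE a. (\<forall>i>n. a i = 0) \<and>
        (\<forall>k. tw_weight0 k - grassmannian_of n c tw_weight0 k = (\<Sum>i=0..n. a i * tw_root n i k)))"

definition atomic_length :: "nat \<Rightarrow> box set \<Rightarrow> real" where
  "atomic_length n c = (\<Sum>i=0..n. tw_coeff n c i)"

end

theory Submission
  imports Defs
begin

text \<open>
  The statement is a shadow of a formula for \<open>e\<close>-cores, with \<open>e = 2n\<close>: if the core \<open>c\<close> arises from
  the empty partition by applying a word \<open>w\<close> in the simple reflections, then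
  \<open>\<Lambda>\<^sub>0 - w \<Lambda>\<^sub>0 = \<Sum>\<^sub>j a\<^sub>j(c) \<alpha>\<^sub>j\<close>.  Doubling it and collecting \<open>\<alpha>\<^sub>j\<close> with \<open>\<alpha>\<^sub>2\<^sub>n\<^sub>-\<^sub>j\<close>, which have equal
  coefficients when \<open>c\<close> is self-conjugate, gives the coefficients \<open>a\<^sub>0\<close>, \<open>2 a\<^sub>j\<close> (\<open>0 < j < n\<close>) and
  \<open>2 a\<^sub>n\<close> in the twisted simple roots.  In their sum every residue class is counted once, except
  the class of \<open>n\<close>, which is counted twice.

  The formula holds because the weight \<open>\<Lambda>\<^sub>0 - \<Sum>\<^sub>j a\<^sub>j(c) \<alpha>\<^sub>j\<close> of any partition pairs with the
  \<open>i\<close>-th simple coroot to the number of addable minus the number of removable \<open>i\<close>-nodes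
  (\<open>core_weight_coroot\<close>).  A core never has both kinds of \<open>i\<close>-nodes
  (\<open>core_not_addable_and_removable\<close>), so the combinatorial reflection adds exactly as many
  \<open>i\<close>-nodes (or removes as many) as the Weyl reflection subtracts (or adds) copies of \<open>\<alpha>\<^sub>i\<close>
  (\<open>core_weight_core_refl\<close>).  Both facts, and the fact that the reflections preserve cores, are read
  off from the abacus, on which a core is a set of beads closed under shifting by \<open>- e\<close>.

  What remains is to see that the definitions by choice mean what they should, and here one
  fact does the work: a core is determined by its weight (\<open>core_weight_inj\<close>), as the sign of the
  pairings tells which nodes can be removed.  Therefore \<open>w \<cdot> \<emptyset>\<close> depends on \<open>w \<Lambda>\<^sub>0\<close> only; in particular
  it depends neither on a word for \<open>w\<close> nor on the choice of \<open>w\<close> in its coset modulo the finite Weyl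
  group, which fixes \<open>\<Lambda>\<^sub>0\<close>.  Stripping conjugate pairs of node classes from a self-conjugate core
  shows that its weight is in the orbit of \<open>\<Lambda>\<^sub>0\<close> under the twisted Weyl group
  (\<open>tw_weyl_reaches_core\<close>), hence the core is \<open>w \<cdot> \<emptyset>\<close> for a minimal coset representative \<open>w\<close>.
\<close>

section \<open>Rows, diagonals and beads\<close>

definition row_len :: "box set \<Rightarrow> nat \<Rightarrow> nat" where
  "row_len c i = card {j. (i, j) \<in> c}"

definition content :: "box \<Rightarrow> int" where
  "content b = int (snd b) - int (fst b)"

definition diag_len :: "box set \<Rightarrow> int \<Rightarrow> nat" where
  "diag_len c k = card {b \<in> c. content b = k}"

text \<open>
  The beads form the beta-set of the partition, normalised so that the box at the end of a nonempty
  row has the position of the bead of that row as its content.  The empty rows also have beads: they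
  fill all sufficiently negative positions.
\<close>

definition bead :: "box set \<Rightarrow> int \<Rightarrow> bool" where
  "bead c k \<longleftrightarrow> (\<exists>i. k = int (row_len c i) - int i - 1)"

text \<open>
  On an abacus with \<open>e\<close> runners the condition says that all beads are pushed up, without gaps.
\<close>

definition abacus_core :: "nat \<Rightarrow> box set \<Rightarrow> bool" where
  "abacus_core e c \<longleftrightarrow> is_partition c \<and> (\<forall>k. bead c k \<longrightarrow> bead c (k - int e))"

lemma downset_eq_lessThan:
  assumes "finite (S :: nat set)" and "\<And>x y. x \<in> S \<Longrightarrow> y \<le> x \<Longrightarrow> y \<in> S"
  shows "S = {..<card S}"
proof -
  obtain m where m: "m \<notin> S" "\<And>x. x < m \<Longrightarrow> x \<in> S"
    using ex_new_if_finite[OF infinite_UNIV_nat assms(1)] exists_least_iff[of "\<lambda>x. x \<notin> S"]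
    by blast
  then have "S = {..<m}" using assms(2) by (auto simp: not_less) (meson not_less)
  then show ?thesis by simp
qed

lemma partition_finite: "is_partition c \<Longrightarrow> finite c"
  by (simp add: is_partition_def)

lemma partition_down: "is_partition c \<Longrightarrow> (i, j) \<in> c \<Longrightarrow> i' \<le> i \<Longrightarrow> j' \<le> j \<Longrightarrow> (i', j') \<in> c"
  unfolding is_partition_def by blast

lemma partition_empty: "is_partition {}"
  by (simp add: is_partition_def)

lemma row_eq:
  assumes "is_partition c"
  shows "{j. (i, j) \<in> c} = {..<row_len c i}"
  unfolding row_len_def
proof (rule downset_eq_lessThan)
  have "{j. (i, j) \<in> c} \<subseteq> snd ` c" by force
  then show "finite {j. (i, j) \<in> c}"
    using partition_finite[OF assms] finite_surj by blast
qed (use partition_down[OF assms] in auto)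

lemma mem_iff_row_len: "is_partition c \<Longrightarrow> (i, j) \<in> c \<longleftrightarrow> j < row_len c i"
  using row_eq[of c i] by auto

lemma row_len_antimono:
  assumes "is_partition c" "i \<le> i'"
  shows "row_len c i' \<le> row_len c i"
proof (rule ccontr)
  assume "\<not> ?thesis"
  then have "(i', row_len c i) \<in> c" using mem_iff_row_len[OF assms(1)] by simp
  then have "(i, row_len c i) \<in> c" using partition_down[OF assms(1)] assms(2) by blast
  then show False using mem_iff_row_len[OF assms(1)] by simp
qed

lemma partition_diff_iff:
  assumes c: "is_partition c"
  shows "(i, j) \<in> c \<and> is_partition (c - {(i, j)}) \<longleftrightarrow> row_len c i = Suc j \<and> row_len c (Suc i) \<le> j"
    (is "?L \<longleftrightarrow> ?R")
proof
  assume L: ?L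
  have "(i, Suc j) \<notin> c" using L partition_down[of "c - {(i,j)}" i "Suc j" i j] by auto
  moreover have "(Suc i, j) \<notin> c" using L partition_down[of "c - {(i,j)}" "Suc i" j i j] by auto
  ultimately show ?R using L mem_iff_row_len[OF c] by (auto simp: not_less)
next
  assume R: ?R
  then have ij: "(i, j) \<in> c" using mem_iff_row_len[OF c] by simp
  have "(x, y) = (i, j)" if "(x, y) \<in> c" "i \<le> x" "j \<le> y" for x y
  proof -
    have "y < row_len c x" using that mem_iff_row_len[OF c] by simp
    moreover have "row_len c x \<le> row_len c (Suc i)" if "x \<noteq> i"
      using row_len_antimono[OF c, of "Suc i" x] that \<open>i \<le> x\<close> by simp
    ultimately show ?thesis using R that by (cases "x = i") auto
  qed
  then have "is_partition (c - {(i, j)})"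
    unfolding is_partition_def using partition_finite[OF c] partition_down[OF c] by blast
  with ij show ?L by simp
qed

lemma partition_insert_iff:
  assumes c: "is_partition c"
  shows "(i, j) \<notin> c \<and> is_partition (insert (i, j) c) \<longleftrightarrow>
    row_len c i = j \<and> (i = 0 \<or> j < row_len c (i - 1))"
    (is "?L \<longleftrightarrow> ?R")
proof
  assume L: ?L
  have "j = 0 \<or> (i, j - 1) \<in> c"
    using L partition_down[of "insert (i, j) c" i j i "j - 1"] by auto
  moreover have "i = 0 \<or> (i - 1, j) \<in> c"
    using L partition_down[of "insert (i, j) c" i j "i - 1" j] by auto
  ultimately show ?R using L mem_iff_row_len[OF c] by auto
next
  assume R: ?R
  then have ij: "(i, j) \<notin> c" using mem_iff_row_len[OF c] by simp
  have "(x, y) \<in> insert (i, j) c" if "x \<le> i" "y \<le> j" for x y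
  proof (cases "x = i")
    case True
    then show ?thesis using R that mem_iff_row_len[OF c] by auto
  next
    case False
    then have "row_len c (i - 1) \<le> row_len c x" using that row_len_antimono[OF c] by simp
    then show ?thesis using R that False mem_iff_row_len[OF c] by auto
  qed
  then have "is_partition (insert (i, j) c)"
    unfolding is_partition_def using partition_finite[OF c] partition_down[OF c] by auto
  with ij show ?L by simp
qed

lemma row_len_empty: "row_len {} i = 0"
  by (simp add: row_len_def)

lemma bead_row_unique:
  assumes c: "is_partition c"
    and "int (row_len c i) - int i = int (row_len c i') - int i'"
  shows "i = i'"
  using assms(2) row_len_antimono[OF c, of i i'] row_len_antimono[OF c, of i' i]
  by linarith

lemma bead_empty: "bead {} k \<longleftrightarrow> k < 0"
proof
  assume "k < 0"
  then show "bead {} k" unfolding bead_def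
    by (intro exI[of _ "nat (- k - 1)"]) (simp add: row_len_empty)
qed (auto simp: bead_def row_len_empty)

text \<open>
  The bead at \<open>k\<close> records whether the boundary step between the diagonals \<open>k\<close> and \<open>k + 1\<close> is
  horizontal or vertical.  The diagonals grow towards the main diagonal, which accounts for the
  correction at negative \<open>k\<close>.
\<close>

lemma diag_len_diff:
  assumes c: "is_partition c"
  shows "int (diag_len c k) - int (diag_len c (k + 1)) = of_bool (bead c k) - of_bool (k < 0)"
proof -
  define D where "D k = {i. 0 \<le> int i + k \<and> int i + k < int (row_len c i)}" for k
  have bij: "bij_betw fst {b \<in> c. content b = k} (D k)" for k
    by (rule bij_betw_byWitness[where f' = "\<lambda>i. (i, nat (int i + k))"])
      (auto simp: content_def D_def mem_iff_row_len[OF c])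
  have card_D: "diag_len c k = card (D k)" for k
    unfolding diag_len_def by (rule bij_betw_same_card[OF bij])
  have fin_D: "finite (D k)" for k
    using bij_betw_finite[OF bij[of k]] partition_finite[OF c] by simp
  define B where "B = {i. k = int (row_len c i) - int i - 1}"
  define Z where "Z = {i. int i + k = - 1}"
  have card_B: "card B = of_bool (bead c k)" and finB: "finite B"
  proof -
    have "B = {i}" if "i \<in> B" for i using that bead_row_unique[OF c] unfolding B_def by fastforce
    then have "B = {} \<or> (\<exists>i. B = {i})" by blast
    moreover have "bead c k \<longleftrightarrow> B \<noteq> {}" unfolding bead_def B_def by blast
    ultimately show "card B = of_bool (bead c k)" "finite B" by auto
  qed
  have Z: "Z = (if k < 0 then {nat (- k - 1)} else {})" unfolding Z_def by auto
  \<comment> \<open>A row starting no later than diagonal \<open>k + 1\<close> with its bead at \<open>k\<close> or beyond meets diagonal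
    \<open>k\<close> or starts just after it; it meets diagonal \<open>k + 1\<close> or ends just before it.\<close>
  have "D k \<union> Z = D (k + 1) \<union> B" unfolding D_def Z_def B_def by auto
  moreover have "D k \<inter> Z = {}" "D (k + 1) \<inter> B = {}" unfolding D_def Z_def B_def by auto
  ultimately have "card (D k) + card Z = card (D (k + 1)) + card B"
    using card_Un_disjoint fin_D finB Z by (metis finite.emptyI finite.insertI)
  then show ?thesis unfolding card_D card_B Z by (auto split: if_splits)
qed

lemma box_residue_eq_iff:
  "e > 0 \<Longrightarrow> box_residue e b = i \<longleftrightarrow> content b mod int e = int i"
  by (cases b) (auto simp: box_residue_def content_def)

lemma box_residue_less: "e > 0 \<Longrightarrow> box_residue e b < e"
  by (cases b) (simp add: box_residue_def nat_less_iff)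

text \<open>
  Removing the last box of a row moves the bead of that row one step down, which is possible exactly
  if the bead of the next row is not in the way.
\<close>

lemma removable_nodes_bij:
  assumes c: "is_partition c" and e: "e > 0"
  shows "bij_betw content (removable_nodes e i c)
    {k. k mod int e = int i \<and> bead c k \<and> \<not> bead c (k - 1)}"
  unfolding bij_betw_def
proof
  have R: "(x, y) \<in> removable_nodes e i c \<longleftrightarrow> row_len c x = Suc y \<and> row_len c (Suc x) \<le> y
      \<and> content (x, y) mod int e = int i" for x y
    unfolding removable_nodes_def using partition_diff_iff[OF c, of x y] box_residue_eq_iff[OF e]
    by blast
  show "inj_on content (removable_nodes e i c)"
  proof (rule inj_onI, clarify)
    fix x y x' y'
    assume "(x, y) \<in> removable_nodes e i c" "(x', y') \<in> removable_nodes e i c"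
      and "content (x, y) = content (x', y')"
    then show "x = x' \<and> y = y'"
      using bead_row_unique[OF c, of x x'] unfolding R content_def by simp
  qed
  show "content ` removable_nodes e i c = {k. k mod int e = int i \<and> bead c k \<and> \<not> bead c (k - 1)}"
  proof (intro equalityI subsetI)
    fix k assume "k \<in> content ` removable_nodes e i c"
    then obtain b where b: "k = content b" "b \<in> removable_nodes e i c" by blast
    obtain x y where "b = (x, y)" by (cases b)
    with b have xy: "row_len c x = Suc y" "row_len c (Suc x) \<le> y"
      "k = content (x, y)" "k mod int e = int i"
      using R by auto
    have "bead c k" unfolding bead_def using xy by (intro exI[of _ x]) (simp add: content_def)
    moreover have "\<not> bead c (k - 1)"
    proof
      assume "bead c (k - 1)"
      then obtain z where z: "k - 1 = int (row_len c z) - int z - 1" unfolding bead_def by blast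
      show False
        using row_len_antimono[OF c, of z x] row_len_antimono[OF c, of "Suc x" z] z xy
        by (cases "z \<le> x") (auto simp: content_def)
    qed
    ultimately show "k \<in> {k. k mod int e = int i \<and> bead c k \<and> \<not> bead c (k - 1)}" using xy by simp
  next
    fix k assume k: "k \<in> {k. k mod int e = int i \<and> bead c k \<and> \<not> bead c (k - 1)}"
    then obtain x where x: "k = int (row_len c x) - int x - 1" unfolding bead_def by blast
    have "row_len c (Suc x) \<noteq> row_len c x"
      using k x unfolding bead_def by (auto dest: spec[of _ "Suc x"])
    then have "row_len c (Suc x) < row_len c x"
      using row_len_antimono[OF c, of x "Suc x"] by simp
    moreover from this have "content (x, row_len c x - 1) = k"
      using x by (simp add: content_def of_nat_diff)
    ultimately have "(x, row_len c x - 1) \<in> removable_nodes e i c"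
      "k = content (x, row_len c x - 1)"
      unfolding R using k by auto
    then show "k \<in> content ` removable_nodes e i c" by blast
  qed
qed

lemma addable_nodes_bij:
  assumes c: "is_partition c" and e: "e > 0"
  shows "bij_betw content (addable_nodes e i c)
    {k. k mod int e = int i \<and> bead c (k - 1) \<and> \<not> bead c k}"
  unfolding bij_betw_def
proof
  have A: "(x, y) \<in> addable_nodes e i c \<longleftrightarrow> row_len c x = y \<and> (x = 0 \<or> y < row_len c (x - 1))
      \<and> content (x, y) mod int e = int i" for x y
    unfolding addable_nodes_def using partition_insert_iff[OF c, of x y] box_residue_eq_iff[OF e]
    by blast
  show "inj_on content (addable_nodes e i c)"
  proof (rule inj_onI, clarify)
    fix x y x' y'
    assume "(x, y) \<in> addable_nodes e i c" "(x', y') \<in> addable_nodes e i c"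
      and "content (x, y) = content (x', y')"
    then show "x = x' \<and> y = y'"
      using bead_row_unique[OF c, of x x'] unfolding A content_def by simp
  qed
  show "content ` addable_nodes e i c = {k. k mod int e = int i \<and> bead c (k - 1) \<and> \<not> bead c k}"
  proof (intro equalityI subsetI)
    fix k assume "k \<in> content ` addable_nodes e i c"
    then obtain b where b: "k = content b" "b \<in> addable_nodes e i c" by blast
    obtain x y where "b = (x, y)" by (cases b)
    with b have xy: "row_len c x = y" "x = 0 \<or> y < row_len c (x - 1)"
      "k = content (x, y)" "k mod int e = int i"
      using A by auto
    have "bead c (k - 1)" unfolding bead_def using xy by (intro exI[of _ x]) (simp add: content_def)
    moreover have "\<not> bead c k"
    proof
      assume "bead c k"
      then obtain z where z: "k = int (row_len c z) - int z - 1" unfolding bead_def by blast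
      have "z \<le> x - 1" if "z < x" using that by simp
      then show False
        using row_len_antimono[OF c, of z "x - 1"] row_len_antimono[OF c, of x z] z xy
        by (cases "z < x") (auto simp: content_def)
    qed
    ultimately show "k \<in> {k. k mod int e = int i \<and> bead c (k - 1) \<and> \<not> bead c k}" using xy by simp
  next
    fix k assume k: "k \<in> {k. k mod int e = int i \<and> bead c (k - 1) \<and> \<not> bead c k}"
    then obtain x where x: "k = int (row_len c x) - int x" unfolding bead_def by auto
    have "x = 0 \<or> row_len c (x - 1) \<noteq> row_len c x"
      using k x unfolding bead_def by (auto dest: spec[of _ "x - 1"])
    then have "x = 0 \<or> row_len c x < row_len c (x - 1)"
      using row_len_antimono[OF c, of "x - 1" x] by auto
    then have "(x, row_len c x) \<in> addable_nodes e i c" "k = content (x, row_len c x)"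
      unfolding A using x k by (auto simp: content_def)
    then show "k \<in> content ` addable_nodes e i c" by blast
  qed
qed

section \<open>Cores on the abacus\<close>

text \<open>
  The hook of the box \<open>(i, j)\<close> has length \<open>\<beta> - \<gamma>\<close>, where \<open>\<beta>\<close> is the bead of row \<open>i\<close> and \<open>\<gamma>\<close> is the
  gap \<open>j - (length of column j)\<close> that belongs to column \<open>j\<close>.  Thus a bead at \<open>k\<close> above a gap at
  \<open>k - e\<close> produces a hook of length \<open>e\<close>.
\<close>

lemma abacus_core_of_core:
  assumes "c \<in> cores e" and e: "e > 0"
  shows "abacus_core e c"
proof -
  have c: "is_partition c" and hook: "\<And>b. b \<in> c \<Longrightarrow> hook_length c b \<noteq> e"
    using assms unfolding cores_def by auto
  have "bead c (k - int e)" if bk: "bead c k" for k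
  proof (rule ccontr)
    define m where "m = k - int e"
    assume "\<not> bead c (k - int e)"
    then have nb: "m \<noteq> int (row_len c x) - int x - 1" for x unfolding bead_def m_def by blast
    obtain i where i: "k = int (row_len c i) - int i - 1" using bk unfolding bead_def by blast
    \<comment> \<open>The column of the gap \<open>m\<close> consists of the rows whose beads lie above \<open>m\<close>.\<close>
    define P where "P x \<longleftrightarrow> int (row_len c x) - int x - 1 < m" for x
    have "P (nat (int (row_len c 0) - m))"
      unfolding P_def using row_len_antimono[OF c, of 0 "nat (int (row_len c 0) - m)"] by linarith
    then obtain x where x: "P x" "\<And>z. z < x \<Longrightarrow> \<not> P z" using exists_least_iff[of P] by blast
    define j where "j = nat (m + int x)"
    have j: "int j = m + int x" using x(1) unfolding j_def P_def by simp
    have col: "(z, j) \<in> c \<longleftrightarrow> z < x" for z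
    proof
      assume "z < x"
      then obtain y where y: "x = Suc y" "z \<le> y" by (cases x) auto
      have "m < int (row_len c y) - int y - 1" using x(2)[of y] nb[of y] y(1) unfolding P_def by simp
      then show "(z, j) \<in> c"
        using row_len_antimono[OF c y(2)] j y(1) unfolding mem_iff_row_len[OF c] by simp
    next
      assume "(z, j) \<in> c"
      then show "z < x"
        using x(1) j row_len_antimono[OF c, of x z]
        unfolding mem_iff_row_len[OF c] P_def by linarith
    qed
    have "i < x"
      using x(1) i e row_len_antimono[OF c, of x i] unfolding P_def m_def by linarith
    then have ij: "(i, j) \<in> c" using col by simp
    have "{j'. j < j' \<and> (i, j') \<in> c} = {j<..<row_len c i}" "{i'. i < i' \<and> (i', j) \<in> c} = {i<..<x}"
      using mem_iff_row_len[OF c] col by auto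
    then have "hook_length c (i, j) = (row_len c i - Suc j) + (x - Suc i) + 1"
      unfolding hook_length_def by simp
    also have "\<dots> = e"
      using \<open>i < x\<close> ij j i unfolding mem_iff_row_len[OF c] m_def by linarith
    finally show False using hook ij by blast
  qed
  then show ?thesis using c unfolding abacus_core_def by blast
qed

lemma abacus_core_empty: "abacus_core e {}"
  unfolding abacus_core_def by (simp add: partition_empty bead_empty)

lemma abacus_core_shift:
  assumes "abacus_core e c" "bead c k" "k' \<le> k" "k' mod int e = k mod int e"
  shows "bead c k'"
proof -
  have step: "bead c (k - int m * int e)" for m
  proof (induction m)
    case (Suc m)
    then have "bead c (k - int m * int e - int e)"
      using assms(1) unfolding abacus_core_def by blast
    then show ?case by (simp add: algebra_simps)
  qed (use assms(2) in simp)
  have "int e dvd k - k'" using assms(4) by (metis mod_eq_dvd_iff)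
  then obtain q where q: "k - k' = int e * q" by blast
  show ?thesis
  proof (cases "e = 0 \<or> q < 0")
    case True
    then have "k' = k" using q assms(3)
      by (metis add_0 diff_add_cancel diff_ge_0_iff_ge mult_eq_0_iff mult_nonneg_nonpos 
          of_nat_0 of_nat_0_le_iff order_antisym less_imp_le diff_add_cancel)
    then show ?thesis using assms(2) by simp
  next
    case False
    then show ?thesis using step[of "nat q"] q by (simp add: algebra_simps)
  qed
qed

text \<open>
  An addable node is a bead at \<open>k - 1\<close> next to a gap at \<open>k\<close>, a removable one a gap at \<open>l - 1\<close> next to a
  bead at \<open>l\<close>.  For \<open>k\<close> and \<open>l\<close> on the same runner, one of the two gaps is below a bead of its runner.
\<close>

lemma core_not_addable_and_removable:
  assumes c: "abacus_core e c" and e: "e > 0"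
  shows "addable_nodes e i c = {} \<or> removable_nodes e i c = {}"
proof (rule ccontr)
  have p: "is_partition c" using c unfolding abacus_core_def by blast
  assume "\<not> ?thesis"
  then obtain a b where "a \<in> addable_nodes e i c" "b \<in> removable_nodes e i c" by blast
  then obtain k l where k: "k mod int e = int i" "bead c (k - 1)" "\<not> bead c k"
    and l: "l mod int e = int i" "bead c l" "\<not> bead c (l - 1)"
    using bij_betw_apply[OF addable_nodes_bij[OF p e, of i]]
      bij_betw_apply[OF removable_nodes_bij[OF p e, of i]] by blast
  show False
  proof (cases "k \<le> l")
    case True
    then show ?thesis using abacus_core_shift[OF c l(2), of k] k l by simp
  next
    case False
    moreover have "(l - 1) mod int e = (k - 1) mod int e" using k l by (metis mod_diff_left_eq)
    ultimately show ?thesis using abacus_core_shift[OF c k(2), of "l - 1"] l by simp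
  qed
qed

text \<open>
  No box of \<open>R\<close> is forced by any other box of \<open>c\<close>, so all of \<open>R\<close> can go at once.
\<close>

lemma partition_diff_removable:
  assumes "is_partition c" "\<And>b. b \<in> R \<Longrightarrow> is_partition (c - {b})"
  shows "is_partition (c - R)"
proof -
  have "(i', j') \<notin> R" if "(i, j) \<in> c - R" "i' \<le> i" "j' \<le> j" for i j i' j'
    using assms(2)[of "(i', j')"] partition_down[of "c - {(i', j')}" i j i' j'] that by auto
  then show ?thesis
    using assms(1) unfolding is_partition_def by blast
qed

lemma partition_Un_addable:
  assumes "is_partition c" "\<And>b. b \<in> A \<Longrightarrow> is_partition (insert b c)" "finite A"
  shows "is_partition (c \<union> A)"
proof -
  have "(i', j') \<in> c \<union> A" if "(i, j) \<in> A" "i' \<le> i" "j' \<le> j" for i j i' j'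
    using partition_down[OF assms(2)[OF that(1)], of i j i' j'] that by auto
  then show ?thesis
    using assms(1,3) unfolding is_partition_def by blast
qed

lemma residue_neighbours_distinct:
  assumes "(e::nat) \<ge> 2"
  shows "(k::int) mod int e \<noteq> (k + 1) mod int e"
proof
  assume "k mod int e = (k + 1) mod int e"
  then have "int e dvd 1" by (metis add_diff_cancel_left' mod_eq_dvd_iff)
  then show False using assms by simp
qed

lemma card_fibre_bij:
  assumes "bij_betw f A B"
  shows "card {a \<in> A. f a = k} = of_bool (k \<in> B)"
proof (cases "k \<in> B")
  case True
  then obtain a where "a \<in> A" "f a = k" using assms unfolding bij_betw_def by blast
  then have "{a \<in> A. f a = k} = {a}" using assms unfolding bij_betw_def inj_on_def by blast
  with True show ?thesis by simp
next
  case False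
  then have "{a \<in> A. f a = k} = {}" using assms unfolding bij_betw_def by blast
  with False show ?thesis by (simp del: Collect_empty_eq)
qed

lemma partition_diff_removable_nodes:
  "is_partition c \<Longrightarrow> is_partition (c - removable_nodes e i c)"
  by (rule partition_diff_removable) (auto simp: removable_nodes_def)

lemma finite_removable_nodes:
  "is_partition c \<Longrightarrow> finite (removable_nodes e i c)"
  using partition_finite[of c] by (simp add: removable_nodes_def)

lemma addable_nodes_subset:
  assumes "is_partition c"
  shows "addable_nodes e i c \<subseteq> insert (0, row_len c 0) ((\<lambda>(x, y). (Suc x, row_len c (Suc x))) ` c)"
proof
  fix b assume b: "b \<in> addable_nodes e i c"
  obtain x y where xy: "b = (x, y)" by (cases b)
  have *: "row_len c x = y" "x = 0 \<or> y < row_len c (x - 1)"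
    using b partition_insert_iff[OF assms, of x y] unfolding addable_nodes_def xy by auto
  show "b \<in> insert (0, row_len c 0) ((\<lambda>(x, y). (Suc x, row_len c (Suc x))) ` c)"
  proof (cases x)
    case (Suc z)
    then have "(z, y) \<in> c" using * mem_iff_row_len[OF assms] by simp
    then show ?thesis using * Suc xy by force
  qed (use * xy in simp)
qed

lemma finite_addable_nodes:
  "is_partition c \<Longrightarrow> finite (addable_nodes e i c)"
  using finite_subset[OF addable_nodes_subset] partition_finite by blast

lemma partition_Un_addable_nodes:
  "is_partition c \<Longrightarrow> is_partition (c \<union> addable_nodes e i c)"
  using finite_addable_nodes[of c e i]
  by (intro partition_Un_addable) (auto simp: addable_nodes_def)

text \<open>
  Every bead on runner \<open>i\<close> with a gap just below it moves to runner \<open>i - 1\<close>.  Comparing diagonal lengths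
  before and after gives this without tracking rows; \<open>e \<ge> 2\<close> ensures that the two runners differ.
\<close>

lemma bead_diff_removable:
  assumes c: "is_partition c" and e: "e \<ge> 2"
  shows "bead (c - removable_nodes e i c) k \<longleftrightarrow>
    (if k mod int e = int i then bead c k \<and> bead c (k - 1)
     else if (k + 1) mod int e = int i then bead c k \<or> bead c (k + 1)
     else bead c k)"
proof -
  define R where "R = removable_nodes e i c"
  define S where "S = {k. k mod int e = int i \<and> bead c k \<and> \<not> bead c (k - 1)}"
  have bij: "bij_betw content R S"
    using removable_nodes_bij[OF c, of e i] e unfolding R_def S_def by simp
  have d: "int (diag_len (c - R) k) = int (diag_len c k) - of_bool (k \<in> S)" for k
  proof -
    have "R \<subseteq> c" unfolding R_def removable_nodes_def by blast
    then have "{b \<in> R. content b = k} \<subseteq> {b \<in> c. content b = k}"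
      "{b \<in> c - R. content b = k} = {b \<in> c. content b = k} - {b \<in> R. content b = k}" by auto
    moreover have "finite {b \<in> R. content b = k}" using finite_removable_nodes[OF c] R_def by simp
    ultimately have "int (diag_len (c - R) k)
        = int (diag_len c k) - int (card {b \<in> R. content b = k})"
      unfolding diag_len_def
      using card_mono[of "{b \<in> c. content b = k}"] partition_finite[OF c]
      by (simp add: card_Diff_subset of_nat_diff)
    then show ?thesis unfolding card_fibre_bij[OF bij] by simp
  qed
  have p: "is_partition (c - R)" unfolding R_def by (rule partition_diff_removable_nodes[OF c])
  have eq: "(of_bool (bead (c - R) k) :: int)
      = of_bool (bead c k) - of_bool (k \<in> S) + of_bool (k + 1 \<in> S)"
    using diag_len_diff[OF c, of k] diag_len_diff[OF p, of k] unfolding d by linarith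
  show ?thesis
    using eq residue_neighbours_distinct[OF e, of k] unfolding R_def[symmetric] S_def
    by (auto simp: of_bool_def split: if_splits)
qed

lemma bead_Un_addable:
  assumes c: "is_partition c" and e: "e \<ge> 2"
  shows "bead (c \<union> addable_nodes e i c) k \<longleftrightarrow>
    (if k mod int e = int i then bead c k \<or> bead c (k - 1)
     else if (k + 1) mod int e = int i then bead c k \<and> bead c (k + 1)
     else bead c k)"
proof -
  define A where "A = addable_nodes e i c"
  define S where "S = {k. k mod int e = int i \<and> bead c (k - 1) \<and> \<not> bead c k}"
  have bij: "bij_betw content A S"
    using addable_nodes_bij[OF c, of e i] e unfolding A_def S_def by simp
  have d: "int (diag_len (c \<union> A) k) = int (diag_len c k) + of_bool (k \<in> S)" for k
  proof -
    have "A \<inter> c = {}" unfolding A_def addable_nodes_def by blast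
    then have "{b \<in> c. content b = k} \<inter> {b \<in> A. content b = k} = {}"
      "{b \<in> c \<union> A. content b = k} = {b \<in> c. content b = k} \<union> {b \<in> A. content b = k}" by auto
    moreover have "finite {b \<in> A. content b = k}" using finite_addable_nodes[OF c] A_def by simp
    ultimately have "int (diag_len (c \<union> A) k)
        = int (diag_len c k) + int (card {b \<in> A. content b = k})"
      unfolding diag_len_def using partition_finite[OF c] by (simp add: card_Un_disjoint)
    then show ?thesis unfolding card_fibre_bij[OF bij] by simp
  qed
  have p: "is_partition (c \<union> A)" unfolding A_def by (rule partition_Un_addable_nodes[OF c])
  have eq: "(of_bool (bead (c \<union> A) k) :: int)
      = of_bool (bead c k) + of_bool (k \<in> S) - of_bool (k + 1 \<in> S)"
    using diag_len_diff[OF c, of k] diag_len_diff[OF p, of k] unfolding d by linarith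
  show ?thesis
    using eq residue_neighbours_distinct[OF e, of k] unfolding A_def[symmetric] S_def
    by (auto simp: of_bool_def split: if_splits)
qed

text \<open>
  The new position of the beads at level \<open>k\<close> is given by a monotone condition on the old beads near
  \<open>k\<close> that depends on \<open>k\<close> modulo \<open>e\<close> only, so closure under the shift is inherited.
\<close>

lemma abacus_core_core_refl:
  assumes c: "abacus_core e c" and e: "e \<ge> 2"
  shows "abacus_core e (core_refl e i c)"
proof -
  have p: "is_partition c" and shift: "\<And>k. bead c k \<Longrightarrow> bead c (k - int e)"
    using c unfolding abacus_core_def by auto
  have m: "(k - int e) mod int e = k mod int e" "(k - int e + 1) mod int e = (k + 1) mod int e" for k
    by (simp, metis diff_add_eq minus_mod_self2)
  have s: "bead c (k - 1) \<Longrightarrow> bead c (k - int e - 1)" 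
    "bead c (k + 1) \<Longrightarrow> bead c (k - int e + 1)" for k
    using shift[of "k - 1"] shift[of "k + 1"] by (simp_all add: algebra_simps)
  have "abacus_core e (c - removable_nodes e i c)"
    unfolding abacus_core_def bead_diff_removable[OF p e] m
    using partition_diff_removable_nodes[OF p] shift s by auto
  moreover have "abacus_core e (c \<union> addable_nodes e i c)"
    unfolding abacus_core_def bead_Un_addable[OF p e] m
    using partition_Un_addable_nodes[OF p] shift s by auto
  ultimately show ?thesis using c unfolding core_refl_def by simp
qed

section \<open>The weight of a partition\<close>

text \<open>
  The weight \<open>\<Lambda>\<^sub>0 - \<Sum>\<^sub>j a\<^sub>j(c) \<alpha>\<^sub>j\<close> attached to \<open>c\<close> in the Fock space.
\<close>

definition core_weight :: "nat \<Rightarrow> box set \<Rightarrow> weight" where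
  "core_weight e c =
     (\<lambda>k. fund_weight 0 k - (\<Sum>j<e. real (residue_count e j c) * simple_root e j k))"

text \<open>
  For \<open>e \<ge> 3\<close> the two neighbours of a vertex of the cyclic Dynkin diagram are distinct.
\<close>

lemma sum_simple_root:
  assumes e: "e \<ge> 3"
  shows "(\<Sum>j<e. b j * simple_root e j k) =
    (if k < e then 2 * b k - b ((k + 1) mod e) - b ((k + e - 1) mod e) else if k = e then b 0 else 0)"
proof -
  have "(\<Sum>j<e. b j * simple_root e j k)
      = 2 * b k - b ((k + 1) mod e) - b ((k + e - 1) mod e)" if k: "k < e"
  proof -
    define s where "s = (k + 1) mod e"
    define t where "t = (k + e - 1) mod e"
    have s: "s = (if k + 1 = e then 0 else k + 1)" "t = (if k = 0 then e - 1 else k - 1)"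
      using k e unfolding s_def t_def by (auto simp: mod_if)
    have "b j * simple_root e j k = 2 * (if j = k then b j else 0) - (if j = s then b j else 0)
        - (if j = t then b j else 0)" if "j < e" for j
    proof -
      have "(j + 1) mod e = k \<longleftrightarrow> j = t" using that k e unfolding s(2) by (auto simp: mod_if)
      moreover have "s \<noteq> k" "t \<noteq> k" "s \<noteq> t" using k e unfolding s by auto
      ultimately show ?thesis
        using k s_def unfolding simple_root_def cartan_def by auto
    qed
    then have "(\<Sum>j<e. b j * simple_root e j k)
        = (\<Sum>j<e. 2 * (if j = k then b j else 0) - (if j = s then b j else 0)
        - (if j = t then b j else 0))" by (intro sum.cong) auto
    also have "\<dots> = 2 * b k - b s - b t"
    proof -
      have "s < e" "t < e" using e unfolding s_def t_def by auto
      then show ?thesis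
        using k by (simp add: sum_subtractf sum_distrib_left[symmetric] sum.delta)
    qed
    finally show ?thesis unfolding s_def t_def .
  qed
  moreover have "(\<Sum>j<e. b j * simple_root e j e) = (\<Sum>j<e. if j = 0 then b j else 0)"
    by (intro sum.cong) (auto simp: simple_root_def)
  ultimately show ?thesis using e by (auto simp: simple_root_def)
qed

text \<open>
  The shift \<open>s\<close> allows counting the neighbours of a residue class of diagonals.
\<close>

lemma sum_diag_len:
  assumes "finite K" "finite c"
  shows "(\<Sum>k\<in>K. diag_len c (k + s)) = card {b \<in> c. content b - s \<in> K}"
proof -
  have "{b \<in> c. content b - s \<in> K} = (\<Union>k\<in>K. {b \<in> c. content b = k + s})" by auto
  moreover have "card \<dots> = (\<Sum>k\<in>K. card {b \<in> c. content b = k + s})"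
    using assms by (intro card_UN_disjoint) auto
  ultimately show ?thesis by (simp add: diag_len_def)
qed

lemma diag_len_second_diff:
  assumes "is_partition c"
  shows "of_bool (bead c (k - 1) \<and> \<not> bead c k) - (of_bool (bead c k \<and> \<not> bead c (k - 1)) :: int)
    = of_bool (k = 0) + int (diag_len c (k - 1)) + int (diag_len c (k + 1)) - 2 * int (diag_len c k)"
proof -
  have "of_bool (P \<and> \<not> Q) - of_bool (Q \<and> \<not> P) = (of_bool P - of_bool Q :: int)" for P Q
    by auto
  moreover have "of_bool (k - 1 < 0) - of_bool (k < 0) = (of_bool (k = 0) :: int)" by auto
  ultimately show ?thesis
    using diag_len_diff[OF assms, of k] diag_len_diff[OF assms, of "k - 1"] by simp
qed

lemma mod_shift_iff:
  assumes "i < e"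
  shows "(x - 1) mod int e = int i \<longleftrightarrow> x mod int e = int ((i + 1) mod e)"
    "(x + 1) mod int e = int i \<longleftrightarrow> x mod int e = int ((i + e - 1) mod e)"
proof -
  have i: "int i = int i mod int e" using assms by simp
  have "(x - 1) mod int e = int i mod int e \<longleftrightarrow> x mod int e = (int i + 1) mod int e"
    unfolding mod_eq_dvd_iff by (simp add: algebra_simps)
  then show "(x - 1) mod int e = int i \<longleftrightarrow> x mod int e = int ((i + 1) mod e)"
    using i by (simp add: zmod_int add.commute)
  have "(x + 1) mod int e = int i mod int e \<longleftrightarrow> x mod int e = (int i - 1) mod int e"
    unfolding mod_eq_dvd_iff by (simp add: algebra_simps)
  moreover have "int (i + e - 1) = (int i - 1) + int e" using assms by linarith
  ultimately show "(x + 1) mod int e = int i \<longleftrightarrow> x mod int e = int ((i + e - 1) mod e)"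
    using i by (simp add: zmod_int)
qed

text \<open>
  By \<open>diag_len_second_diff\<close> the identity holds on each diagonal separately; here it is summed over the
  diagonals of residue \<open>i\<close>.  The neighbouring diagonals make up the residues \<open>i - 1\<close> and \<open>i + 1\<close>, and
  the summand \<open>of_bool (k = 0)\<close> becomes the pairing with \<open>\<Lambda>\<^sub>0\<close>.
\<close>

lemma core_weight_coroot:
  assumes c: "is_partition c" and e: "e \<ge> 3" and i: "i < e"
  shows "core_weight e c i = real (card (addable_nodes e i c)) - real (card (removable_nodes e i c))"
proof -
  \<comment> \<open>Outside of the finite set \<open>V\<close> all terms of the identity vanish, and in particular there are
    neither addable nor removable nodes.\<close>
  define U where "U = content ` c"
  define V where "V = insert 0 (U \<union> (\<lambda>k. k + 1) ` U \<union> (\<lambda>k. k - 1) ` U)"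
  define K where "K = {k \<in> V. k mod int e = int i}"
  define AS where "AS = {k. k mod int e = int i \<and> bead c (k - 1) \<and> \<not> bead c k}"
  define RS where "RS = {k. k mod int e = int i \<and> bead c k \<and> \<not> bead c (k - 1)}"
  have e0: "e > 0" using e by simp
  have fc: "finite c" by (rule partition_finite[OF c])
  have V: "k \<in> V \<longleftrightarrow> k = 0 \<or> k \<in> U \<or> k - 1 \<in> U \<or> k + 1 \<in> U" for k
  proof -
    have "k \<in> (\<lambda>k. k + 1) ` U \<longleftrightarrow> k - 1 \<in> U"
      by (metis (no_types, lifting) add_diff_cancel_right' diff_add_cancel image_iff)
    moreover have "k \<in> (\<lambda>k. k - 1) ` U \<longleftrightarrow> k + 1 \<in> U"
      by (metis (no_types, lifting) add_diff_cancel_right' diff_add_cancel image_iff)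
    ultimately show ?thesis unfolding V_def by blast
  qed
  have U: "content b \<in> U" if "b \<in> c" for b using that unfolding U_def by blast
  have finK: "finite K" using fc unfolding K_def V_def U_def by simp
  have d0: "diag_len c k = 0" if "k \<notin> U" for k
  proof -
    have "{b \<in> c. content b = k} = {}" using that unfolding U_def by blast
    then show ?thesis unfolding diag_len_def by (metis card.empty)
  qed
  have inV: "k \<in> V" if "bead c k \<noteq> bead c (k - 1)" for k
  proof (rule ccontr)
    assume k: "k \<notin> V"
    then have "k \<notin> U" "k + 1 \<notin> U" "k - 1 \<notin> U" "k \<noteq> 0"
      unfolding V by auto
    then show False
      using diag_len_second_diff[OF c, of k] d0 that by (auto simp: of_bool_def split: if_splits)
  qed
  have AS: "AS = {k \<in> K. bead c (k - 1) \<and> \<not> bead c k}"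
    and RS: "RS = {k \<in> K. bead c k \<and> \<not> bead c (k - 1)}"
    using inV unfolding AS_def RS_def K_def by auto
  have cA: "int (card (addable_nodes e i c)) = (\<Sum>k\<in>K. of_bool (bead c (k - 1) \<and> \<not> bead c k))"
    using bij_betw_same_card[OF addable_nodes_bij[OF c e0, of i]] finK 
    unfolding AS_def[symmetric] unfolding AS by (simp add: of_bool_def sum.If_cases Int_def)
  have cR: "int (card (removable_nodes e i c)) = (\<Sum>k\<in>K. of_bool (bead c k \<and> \<not> bead c (k - 1)))"
    using bij_betw_same_card[OF removable_nodes_bij[OF c e0, of i]] finK 
    unfolding RS_def[symmetric] unfolding RS by (simp add: of_bool_def sum.If_cases Int_def)
  have a: "(\<Sum>k\<in>K. int (diag_len c (k + s))) = int (card {b \<in> c. content b - s \<in> K})" for s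
    using sum_diag_len[OF finK fc, of s] by (metis of_nat_sum)
  have "{b \<in> c. content b - 0 \<in> K} = {b \<in> c. box_residue e b = i}"
    unfolding K_def V by (auto simp: U box_residue_eq_iff[OF e0])
  then have a0: "(\<Sum>k\<in>K. int (diag_len c k)) = int (residue_count e i c)"
    using a[of 0] by (simp add: residue_count_def)
  have "{b \<in> c. content b - 1 \<in> K} = {b \<in> c. box_residue e b = (i + 1) mod e}"
    unfolding K_def V
    by (auto simp: U box_residue_eq_iff[OF e0] mod_shift_iff[OF i])
  then have a1: "(\<Sum>k\<in>K. int (diag_len c (k + 1))) = int (residue_count e ((i + 1) mod e) c)"
    using a[of 1] by (simp add: residue_count_def)
  have "{b \<in> c. content b - (- 1) \<in> K} = {b \<in> c. box_residue e b = (i + e - 1) mod e}"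
    unfolding K_def V
    by (auto simp: U box_residue_eq_iff[OF e0] mod_shift_iff[OF i])
  then have a2: "(\<Sum>k\<in>K. int (diag_len c (k - 1))) = int (residue_count e ((i + e - 1) mod e) c)"
    using a[of "-1"] by (simp add: residue_count_def)
  have z: "(\<Sum>k\<in>K. of_bool (k = 0)) = (of_bool (i = 0) :: int)"
  proof -
    have "(\<Sum>k\<in>K. of_bool (k = 0)) = (of_bool (0 \<in> K) :: int)"
      using finK by (simp add: of_bool_def)
    also have "0 \<in> K \<longleftrightarrow> i = 0" unfolding K_def V by auto
    finally show ?thesis .
  qed
  have "int (card (addable_nodes e i c)) - int (card (removable_nodes e i c))
      = of_bool (i = 0) + int (residue_count e ((i + e - 1) mod e) c)
        + int (residue_count e ((i + 1) mod e) c) - 2 * int (residue_count e i c)"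
    unfolding cA cR sum_subtractf[symmetric] diag_len_second_diff[OF c]
    by (simp add: sum.distrib sum_subtractf sum_distrib_left[symmetric] a0 a1 a2 z)
  from arg_cong[OF this, of real_of_int]
  have "real (card (addable_nodes e i c)) - real (card (removable_nodes e i c))
      = of_bool (i = 0) + real (residue_count e ((i + e - 1) mod e) c)
        + real (residue_count e ((i + 1) mod e) c) - 2 * real (residue_count e i c)"
    by (simp only: of_int_diff of_int_add of_int_of_nat_eq of_int_mult of_int_numeral of_int_of_bool)
  then show ?thesis
    using i unfolding core_weight_def sum_simple_root[OF e] fund_weight_def by auto
qed

lemma core_weight_change:
  assumes "i < e"
    and "\<And>j. j < e \<Longrightarrow> real (residue_count e j d) = real (residue_count e j c) + (if j = i then x else 0)"
  shows "core_weight e d = (\<lambda>k. core_weight e c k - x * simple_root e i k)"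
proof
  fix k
  have "(\<Sum>j<e. real (residue_count e j d) * simple_root e j k)
      = (\<Sum>j<e. real (residue_count e j c) * simple_root e j k + (if j = i then x * simple_root e j k else 0))"
    using assms(2) by (intro sum.cong) (auto simp: algebra_simps)
  also have "\<dots> = (\<Sum>j<e. real (residue_count e j c) * simple_root e j k) + x * simple_root e i k"
    using assms(1) by (simp add: sum.distrib sum.delta)
  finally show "core_weight e d k = core_weight e c k - x * simple_root e i k"
    unfolding core_weight_def by simp
qed

text \<open>
  In a core one of the two numbers whose difference is the pairing is zero, so the other one is the
  number of nodes moved.
\<close>

lemma core_weight_core_refl:
  assumes c: "abacus_core e c" and e: "e \<ge> 3" and i: "i < e"
  shows "core_weight e (core_refl e i c) = weight_refl e i (core_weight e c)"
proof -
  have p: "is_partition c" using c unfolding abacus_core_def by blast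
  define R where "R = removable_nodes e i c"
  define A where "A = addable_nodes e i c"
  have "A = {} \<or> R = {}"
    using core_not_addable_and_removable[OF c, of i] e unfolding A_def R_def by simp
  have w: "core_weight e c i = real (card A) - real (card R)"
    unfolding A_def R_def by (rule core_weight_coroot[OF p e i])
  have fin: "finite c" "finite A" "finite R"
    unfolding A_def R_def
    using partition_finite[OF p] finite_addable_nodes[OF p] finite_removable_nodes[OF p] by auto
  have R: "b \<in> c" "box_residue e b = i" if "b \<in> R" for b
    using that unfolding R_def removable_nodes_def by auto
  have A: "b \<notin> c" "box_residue e b = i" if "b \<in> A" for b
    using that unfolding A_def addable_nodes_def by auto
  have minus: "core_weight e (c - R) = (\<lambda>k. core_weight e c k - (- real (card R)) * simple_root e i k)"
  proof (rule core_weight_change[OF i])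
    fix j
    have "{b \<in> c - R. box_residue e b = j} = {b \<in> c. box_residue e b = j} - (if j = i then R else {})"
      using R by auto
    moreover have "(if j = i then R else {}) \<subseteq> {b \<in> c. box_residue e b = j}"
      using R by auto
    ultimately have "residue_count e j c = residue_count e j (c - R) + (if j = i then card R else 0)"
      unfolding residue_count_def using fin
        card_mono[of "{b \<in> c. box_residue e b = j}" "if j = i then R else {}"]
      by (simp add: card_Diff_subset)
    then show "real (residue_count e j (c - R))
        = real (residue_count e j c) + (if j = i then - real (card R) else 0)" by simp
  qed
  have plus: "core_weight e (c \<union> A) = (\<lambda>k. core_weight e c k - real (card A) * simple_root e i k)"
  proof (rule core_weight_change[OF i])
    fix j
    have "{b \<in> c \<union> A. box_residue e b = j} = {b \<in> c. box_residue e b = j} \<union> (if j = i then A else {})"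
      "{b \<in> c. box_residue e b = j} \<inter> (if j = i then A else {}) = {}"
      using A by auto
    then have "residue_count e j (c \<union> A) = residue_count e j c + (if j = i then card A else 0)"
      unfolding residue_count_def using fin by (simp add: card_Un_disjoint)
    then show "real (residue_count e j (c \<union> A))
        = real (residue_count e j c) + (if j = i then real (card A) else 0)" by simp
  qed
  show ?thesis
  proof (cases "R = {}")
    case True
    then have "core_refl e i c = c \<union> A" unfolding core_refl_def R_def A_def by auto
    then show ?thesis using plus w True unfolding weight_refl_def by simp
  next
    case False
    then have "core_refl e i c = c - R" "A = {}"
      using \<open>A = {} \<or> R = {}\<close> unfolding core_refl_def R_def by auto
    then show ?thesis using minus w unfolding weight_refl_def by simp
  qed
qed

lemma weight_refl_involution: "i < e \<Longrightarrow> weight_refl e i (weight_refl e i x) = x"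
  by (rule ext) (simp add: weight_refl_def simple_root_def cartan_def algebra_simps)

lemma removable_core_weight:
  assumes "abacus_core e c" "e \<ge> 3" "i < e"
  shows "removable_nodes e i c \<noteq> {} \<longleftrightarrow> core_weight e c i < 0"
proof -
  have p: "is_partition c" using assms(1) unfolding abacus_core_def by blast
  have "finite (removable_nodes e i c)" by (rule finite_removable_nodes[OF p])
  then have "removable_nodes e i c \<noteq> {} \<longleftrightarrow> card (removable_nodes e i c) > 0"
    by (simp add: card_gt_0_iff)
  moreover have "card (addable_nodes e i c) = 0 \<or> card (removable_nodes e i c) = 0"
    using core_not_addable_and_removable[OF assms(1), of i] assms(2) by auto
  ultimately show ?thesis unfolding core_weight_coroot[OF p assms(2,3)] by auto
qed

text \<open>
  The removed nodes are addable afterwards.  There are no further addable nodes, since the pairing with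
  the coroot has only changed its sign.
\<close>

lemma core_refl_undo:
  assumes c: "abacus_core e c" and e: "e \<ge> 3" and i: "i < e"
    and ne: "removable_nodes e i c \<noteq> {}"
  shows "core_refl e i (core_refl e i c) = c"
proof -
  have p: "is_partition c" using c unfolding abacus_core_def by blast
  define R where "R = removable_nodes e i c"
  define d where "d = core_refl e i c"
  have d: "d = c - R" using ne unfolding d_def core_refl_def R_def by simp
  have Rc: "R \<subseteq> c" unfolding R_def removable_nodes_def by blast
  have dc: "abacus_core e d" unfolding d_def using abacus_core_core_refl[OF c] e by simp
  then have dp: "is_partition d" unfolding abacus_core_def by blast
  have sub: "R \<subseteq> addable_nodes e i d"
  proof
    fix b assume b: "b \<in> R"
    have "is_partition (c - (R - {b}))"
      by (rule partition_diff_removable[OF p]) (auto simp: R_def removable_nodes_def)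
    moreover have "insert b d = c - (R - {b})" using b Rc unfolding d by blast
    ultimately show "b \<in> addable_nodes e i d"
      using b unfolding addable_nodes_def d R_def removable_nodes_def by auto
  qed
  then have nr: "removable_nodes e i d = {}"
    using core_not_addable_and_removable[OF dc, of i] e ne unfolding R_def by auto
  have na: "addable_nodes e i c = {}"
    using core_not_addable_and_removable[OF c, of i] e ne by auto
  have "core_weight e d i = - core_weight e c i"
    using core_weight_core_refl[OF c e i] i
    unfolding d_def weight_refl_def simple_root_def cartan_def by simp
  then have "card (addable_nodes e i d) = card R"
    unfolding core_weight_coroot[OF p e i] core_weight_coroot[OF dp e i] nr na R_def by simp
  then have "addable_nodes e i d = R"
    using card_subset_eq[OF finite_addable_nodes[OF dp] sub] by simp
  then have "core_refl e i d = d \<union> R" using nr ne unfolding core_refl_def R_def by simp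
  then show ?thesis using Rc d unfolding d_def by blast
qed

lemma ex_removable:
  assumes p: "is_partition c" and "c \<noteq> {}" "e > 0"
  obtains i where "i < e" "removable_nodes e i c \<noteq> {}"
proof -
  \<comment> \<open>A box on the outermost antidiagonal is a corner.\<close>
  define f where "f b = fst b + snd b" for b :: box
  have fin: "finite (f ` c)" using partition_finite[OF p] by simp
  obtain b where b: "b \<in> c" "f b = Max (f ` c)"
    using Max_in[OF fin] assms(2) by (metis (no_types, lifting) imageE image_is_empty)
  have le: "f b' \<le> f b" if "b' \<in> c" for b' using Max_ge[OF fin] that b(2) by simp
  obtain x y where xy: "b = (x, y)" by (cases b)
  have "(x, Suc y) \<notin> c" "(Suc x, y) \<notin> c" using le[of "(x, Suc y)"] le[of "(Suc x, y)"]
    unfolding f_def xy by auto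
  then have "is_partition (c - {b})"
    using partition_diff_iff[OF p, of x y] b(1) mem_iff_row_len[OF p] unfolding xy
    by (auto simp: not_less)
  then have "b \<in> removable_nodes e (box_residue e b) c"
    using b(1) unfolding removable_nodes_def by simp
  then show ?thesis using that box_residue_less[OF \<open>e > 0\<close>] by blast
qed

lemma core_weight_empty: "core_weight e {} = fund_weight 0"
  unfolding core_weight_def residue_count_def by simp

lemma card_core_refl_less:
  assumes "finite c" "removable_nodes e i c \<noteq> {}"
  shows "card (core_refl e i c) < card c"
proof -
  have "core_refl e i c \<subset> c" using assms(2) unfolding core_refl_def removable_nodes_def by auto
  then show ?thesis using psubset_card_mono[OF assms(1)] by blast
qed

text \<open>
  The pairings of the weight tell for which \<open>i\<close> there are removable \<open>i\<close>-nodes.  Removing them from both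
  cores leads to smaller cores, again with equal weights, and the removal can be undone.
\<close>

lemma core_weight_inj:
  assumes "e \<ge> 3" "abacus_core e c" "abacus_core e d" "core_weight e c = core_weight e d"
  shows "c = d"
  using assms(2-)
proof (induction "card c" arbitrary: c d rule: less_induct)
  case less
  note e = \<open>e \<ge> 3\<close>
  have p: "is_partition c" "is_partition d" using less.prems unfolding abacus_core_def by auto
  show ?case
  proof (cases "c = {}")
    case True
    have "d = {}"
    proof (rule ccontr)
      assume "d \<noteq> {}"
      then obtain i where "i < e" "removable_nodes e i d \<noteq> {}"
        using ex_removable[OF p(2), of e] e by auto
      then have "core_weight e {} i < 0"
        using removable_core_weight[OF less.prems(2) e] less.prems(3) True by simp
      then show False unfolding core_weight_empty fund_weight_def by (simp split: if_splits)
    qed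
    with True show ?thesis by simp
  next
    case False
    then obtain i where i: "i < e" and c: "removable_nodes e i c \<noteq> {}"
      using ex_removable[OF p(1), of e] e by auto
    then have d: "removable_nodes e i d \<noteq> {}"
      using removable_core_weight[OF _ e i] less.prems by simp
    have "core_refl e i c = core_refl e i d"
    proof (rule less.hyps)
      show "card (core_refl e i c) < card c"
        by (rule card_core_refl_less[OF partition_finite[OF p(1)] c])
      show "core_weight e (core_refl e i c) = core_weight e (core_refl e i d)"
        using core_weight_core_refl[OF _ e i] less.prems by simp
      show "abacus_core e (core_refl e i c)" "abacus_core e (core_refl e i d)"
        using abacus_core_core_refl less.prems(1,2) e by simp_all
    qed
    then show ?thesis
      using core_refl_undo[OF less.prems(1) e i c] core_refl_undo[OF less.prems(2) e i d] by metis
  qed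
qed

lemma word_weight:
  assumes e: "e \<ge> 3" and "set js \<subseteq> {..<e}"
  shows "abacus_core e (foldr (core_refl e) js {})"
    and "core_weight e (foldr (core_refl e) js {}) = foldr (weight_refl e) js (fund_weight 0)"
  using assms(2)
proof (induction js)
  case Nil
  { case 1 show ?case by (simp add: abacus_core_empty) }
  { case 2 show ?case by (simp add: core_weight_empty) }
next
  case (Cons i js)
  { case 1 then show ?case using Cons.IH(1) abacus_core_core_refl e by simp }
  { case 2 then show ?case using Cons.IH core_weight_core_refl[OF _ e, of _ i] by simp }
qed

text \<open>
  The weight of the resulting core is \<open>w \<Lambda>\<^sub>0\<close> for every word of \<open>w\<close>, hence all words lead to the same
  core.
\<close>

lemma core_act_word:
  assumes e: "e \<ge> 3" and "set js \<subseteq> {..<e}" and w: "w = foldr (weight_refl e) js"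
  shows "core_act e w {} = foldr (core_refl e) js {}"
  unfolding core_act_def
proof (rule the_equality)
  show "\<exists>js'. set js' \<subseteq> {..<e} \<and> w = foldr (weight_refl e) js'
      \<and> foldr (core_refl e) js {} = foldr (core_refl e) js' {}"
    using assms by blast
next
  fix d assume "\<exists>js'. set js' \<subseteq> {..<e} \<and> w = foldr (weight_refl e) js' \<and> d = foldr (core_refl e) js' {}"
  then obtain js' where js': "set js' \<subseteq> {..<e}" "w = foldr (weight_refl e) js'"
    "d = foldr (core_refl e) js' {}" by blast
  show "d = foldr (core_refl e) js {}"
    unfolding js'(3)
    by (rule core_weight_inj[OF e]) (use word_weight[OF e] assms js' in auto)
qed

section \<open>Self-conjugate cores\<close>

lemma eq_swap_image:
  assumes "\<And>b. prod.swap b \<in> A \<longleftrightarrow> b \<in> B"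
  shows "A = prod.swap ` B"
proof (rule Set.set_eqI)
  fix x
  have "x \<in> prod.swap ` B \<longleftrightarrow> prod.swap x \<in> B" by (cases x) force
  then show "x \<in> A \<longleftrightarrow> x \<in> prod.swap ` B" using assms[of "prod.swap x"] by simp
qed

lemma conjugate_fixed_mem:
  assumes "conjugate c = c"
  shows "prod.swap b \<in> c \<longleftrightarrow> b \<in> c"
proof -
  have "prod.swap b \<in> prod.swap ` c \<longleftrightarrow> b \<in> c" by (cases b) force
  then show ?thesis using assms unfolding conjugate_def by simp
qed

lemma partition_conjugate: "is_partition c \<Longrightarrow> is_partition (conjugate c)"
  unfolding is_partition_def conjugate_def by fastforce

text \<open>
  Transposing a box negates its content; the outer \<open>mod\<close> is for \<open>i = 0\<close>.
\<close>

lemma box_residue_swap: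
  assumes "i < e"
  shows "box_residue e (prod.swap b) = (e - i) mod e \<longleftrightarrow> box_residue e b = i"
proof -
  have e: "e > 0" and i: "int i = int i mod int e" using assms by auto
  have c: "content (prod.swap b) = - content b" unfolding content_def by simp
  have "int ((e - i) mod e) = (int e - int i) mod int e" using assms by (simp add: zmod_int of_nat_diff)
  also have "\<dots> = (- int i) mod int e" by (simp add: mod_eq_dvd_iff)
  finally have *: "int ((e - i) mod e) = (- int i) mod int e" .
  have "(- content b) mod int e = (- int i) mod int e \<longleftrightarrow> content b mod int e = int i mod int e"
    unfolding mod_eq_dvd_iff using dvd_diff_commute[of "int e" "content b"] by simp
  then show ?thesis unfolding box_residue_eq_iff[OF e] c * using i by simp
qed

lemma residue_count_conjugate:
  assumes "conjugate c = c" "i < e"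
  shows "residue_count e ((e - i) mod e) c = residue_count e i c"
proof -
  have "{b \<in> c. box_residue e b = (e - i) mod e} = prod.swap ` {b \<in> c. box_residue e b = i}"
    by (rule eq_swap_image)
      (use conjugate_fixed_mem[OF assms(1)] box_residue_swap[OF assms(2)] in blast)
  then show ?thesis unfolding residue_count_def by (simp add: card_image)
qed

lemma removable_nodes_conjugate:
  assumes "conjugate c = c" "i < e"
  shows "removable_nodes e ((e - i) mod e) c = prod.swap ` removable_nodes e i c"
proof -
  have "is_partition (c - {prod.swap b})" if "is_partition (c - {b})" for b
  proof -
    have "conjugate (c - {b}) = c - {prod.swap b}"
      using assms(1) unfolding conjugate_def by (simp add: image_set_diff)
    then show ?thesis using partition_conjugate[OF that] by simp
  qed
  then have "is_partition (c - {prod.swap b}) \<longleftrightarrow> is_partition (c - {b})" for b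
    by (metis swap_swap)
  then have "prod.swap b \<in> removable_nodes e ((e - i) mod e) c \<longleftrightarrow> b \<in> removable_nodes e i c" for b
    unfolding removable_nodes_def
    using conjugate_fixed_mem[OF assms(1)] box_residue_swap[OF assms(2)] by blast
  then show ?thesis by (rule eq_swap_image)
qed

lemma conjugate_diff_removable:
  assumes "conjugate c = c" "i < e"
  shows "conjugate (c - removable_nodes e i c - removable_nodes e ((e - i) mod e) c)
    = c - removable_nodes e i c - removable_nodes e ((e - i) mod e) c"
proof -
  have "prod.swap ` prod.swap ` removable_nodes e i c = removable_nodes e i c"
    by (simp add: image_image)
  then show ?thesis
    unfolding removable_nodes_conjugate[OF assms] conjugate_def
    using assms(1) by (auto simp: image_set_diff conjugate_def)
qed

text \<open>
  Non-adjacent reflections do not interfere: the \<open>j\<close>-nodes removable from \<open>c\<close> stay removable, and no new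
  ones appear since the pairing with the \<open>j\<close>-th coroot is unchanged.
\<close>

lemma far_removable_nodes:
  assumes c: "abacus_core e c" and e: "e \<ge> 3" and ij: "i < e" "j < e" "i \<noteq> j" "cartan e j i = 0"
    and ne: "removable_nodes e i c \<noteq> {}" "removable_nodes e j c \<noteq> {}"
  shows "removable_nodes e j (core_refl e i c) = removable_nodes e j c"
proof -
  define d where "d = core_refl e i c"
  have d: "d = c - removable_nodes e i c" using ne unfolding d_def core_refl_def by simp
  have p: "is_partition c" using c unfolding abacus_core_def by blast
  have dc: "abacus_core e d" unfolding d_def using abacus_core_core_refl[OF c] e by simp
  then have dp: "is_partition d" unfolding abacus_core_def by blast
  have sub: "removable_nodes e j c \<subseteq> removable_nodes e j d"
  proof
    fix b assume b: "b \<in> removable_nodes e j c"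
    have "is_partition (c - insert b (removable_nodes e i c))"
      by (rule partition_diff_removable[OF p]) (use b in \<open>auto simp: removable_nodes_def\<close>)
    moreover have "d - {b} = c - insert b (removable_nodes e i c)" unfolding d by blast
    ultimately show "b \<in> removable_nodes e j d"
      using b ij unfolding removable_nodes_def d by auto
  qed
  have "addable_nodes e j c = {}" "addable_nodes e j d = {}"
    using core_not_addable_and_removable[OF c, of j] core_not_addable_and_removable[OF dc, of j]
      e ne sub by auto
  moreover have "core_weight e d j = core_weight e c j"
    unfolding d_def core_weight_core_refl[OF c e ij(1)]
    using ij by (simp add: weight_refl_def simple_root_def)
  ultimately have "card (removable_nodes e j c) = card (removable_nodes e j d)"
    unfolding core_weight_coroot[OF p e ij(2)] core_weight_coroot[OF dp e ij(2)] by simp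
  then show ?thesis
    using card_subset_eq[OF finite_removable_nodes[OF dp] sub] unfolding d_def by simp
qed

section \<open>Words in involutions\<close>

lemma mult_weight_perms: "bij f \<Longrightarrow> bij g \<Longrightarrow> f \<otimes>\<^bsub>weight_perms\<^esub> g = f \<circ> g"
  by (simp add: BijGroup_def Bij_def compose_eq extensional_def compose_def fun_eq_iff)

lemma one_weight_perms: "\<one>\<^bsub>weight_perms\<^esub> = id"
  by (simp add: BijGroup_def fun_eq_iff)

lemma inv_weight_perms: "bij f \<Longrightarrow> inv\<^bsub>weight_perms\<^esub> f = inv_into UNIV f"
  by (subst inv_BijGroup) (auto simp: Bij_def extensional_def)

text \<open>
  Words, and not only generators, need to be bijective: the product in \<open>BijGroup\<close> is composition on
  bijections only.
\<close>

lemma bij_foldr: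
  assumes "\<And>i. i \<in> I \<Longrightarrow> f i \<circ> f i = id" and "set ws \<subseteq> I"
  shows "bij (foldr f ws)"
  using assms(2) by (induction ws) (auto intro!: bij_comp o_bij[OF assms(1) assms(1)])

lemma foldr_append_comp: "foldr f (xs @ ys) = foldr f xs \<circ> foldr f ys"
  by (simp add: fun_eq_iff)

lemma generate_involutions:
  assumes inv: "\<And>i. i \<in> I \<Longrightarrow> f i \<circ> f i = id"
  shows "generate weight_perms (f ` I) = {foldr f ws | ws. set ws \<subseteq> I}" (is "?G = ?W")
proof (intro subset_antisym subsetI)
  fix w assume "w \<in> ?G"
  then show "w \<in> ?W"
  proof (induction rule: generate.induct)
    case one
    show ?case unfolding one_weight_perms by (auto intro!: exI[of _ "[]"] simp: fun_eq_iff)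
  next
    case (incl h)
    then obtain i where "i \<in> I" "h = f i" by blast
    then show ?case by (auto intro!: exI[of _ "[i]"] simp: fun_eq_iff)
  next
    case (inv h)
    then obtain i where i: "i \<in> I" "h = f i" by blast
    have "inv_into UNIV (f i) = f i"
      using inv_unique_comp assms[OF i(1)] by blast
    then have "inv\<^bsub>weight_perms\<^esub> h = f i"
      using inv_weight_perms[OF o_bij[OF assms assms]] i by simp
    then show ?case using i(1) by (auto intro!: exI[of _ "[i]"] simp: fun_eq_iff)
  next
    case (eng h1 h2)
    then obtain w1 w2 where w: "set w1 \<subseteq> I" "h1 = foldr f w1" "set w2 \<subseteq> I" "h2 = foldr f w2"
      by blast
    then have "h1 \<otimes>\<^bsub>weight_perms\<^esub> h2 = foldr f (w1 @ w2)"
      using mult_weight_perms bij_foldr[of I f, OF inv] unfolding foldr_append_comp by simp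
    moreover have "set (w1 @ w2) \<subseteq> I" using w by simp
    ultimately show ?case by blast
  qed
next
  fix w assume "w \<in> ?W"
  then obtain ws where ws: "set ws \<subseteq> I" "w = foldr f ws" by blast
  have "foldr f ws \<in> ?G" using ws(1)
  proof (induction ws)
    case Nil
    have "foldr f [] = \<one>\<^bsub>weight_perms\<^esub>" unfolding one_weight_perms by (simp add: fun_eq_iff)
    then show ?case using generate.one[of weight_perms] by metis
  next
    case (Cons i ws)
    have "foldr f (i # ws) = f i \<otimes>\<^bsub>weight_perms\<^esub> foldr f ws"
      using Cons.prems mult_weight_perms[OF o_bij[OF inv inv] bij_foldr[of I f, OF inv]] by simp
    moreover have "f i \<in> ?G" using Cons.prems by (intro generate.incl) simp
    ultimately show ?case using Cons generate.eng by simp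
  qed
  then show "w \<in> ?G" using ws by simp
qed

lemma foldr_weight_refl_scale:
  "foldr (weight_refl e) js (\<lambda>k. a * x k) = (\<lambda>k. a * foldr (weight_refl e) js x k)"
  by (induction js) (auto simp: weight_refl_def algebra_simps)

section \<open>The twisted Weyl group\<close>

lemma cartan_opposite:
  assumes "0 < i" "i < n"
  shows "cartan (2 * n) i (2 * n - i) = 0" "cartan (2 * n) (2 * n - i) i = 0"
  using assms by (auto simp: cartan_def mod_if)

lemma tw_refl_involution:
  assumes "n \<ge> 2" "i \<le> n"
  shows "tw_refl n i \<circ> tw_refl n i = id"
proof (cases "i = 0 \<or> i = n")
  case True
  then show ?thesis
    using weight_refl_involution[of i "2 * n"] assms by (auto simp: tw_refl_def fun_eq_iff)
next
  case False
  then have i: "0 < i" "i < n" using assms by auto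
  then have lt: "i < 2 * n" "2 * n - i < 2 * n" by auto
  have comm: "weight_refl (2 * n) i (weight_refl (2 * n) (2 * n - i) x)
      = weight_refl (2 * n) (2 * n - i) (weight_refl (2 * n) i x)" for x
    using lt cartan_opposite[OF i] by (auto simp: weight_refl_def simple_root_def)
  have "tw_refl n i (tw_refl n i x) = x" for x
    using False by (simp add: tw_refl_def comm weight_refl_involution lt)
  then show ?thesis by (simp add: fun_eq_iff)
qed

lemma tw_weyl_eq:
  assumes "n \<ge> 2"
  shows "tw_weyl n = {foldr (tw_refl n) ws | ws. set ws \<subseteq> {0..n}}"
    and "tw_fin_weyl n = {foldr (tw_refl n) ws | ws. set ws \<subseteq> {1..n}}"
  unfolding tw_weyl_def tw_fin_weyl_def
  using tw_refl_involution[OF assms] by (intro generate_involutions; simp)+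

lemma tw_word_weight_word:
  assumes "n \<ge> 2" "set ws \<subseteq> {0..n}"
  shows "\<exists>js. set js \<subseteq> {..<2 * n} \<and> foldr (tw_refl n) ws = foldr (weight_refl (2 * n)) js"
  using assms(2)
proof (induction ws)
  case Nil
  show ?case by (intro exI[of _ "[]"]) simp
next
  case (Cons i ws)
  then obtain js where js: "set js \<subseteq> {..<2 * n}"
    "foldr (tw_refl n) ws = foldr (weight_refl (2 * n)) js" by auto
  show ?case
  proof (cases "i = 0 \<or> i = n")
    case True
    then have "tw_refl n i = weight_refl (2 * n) i" by (simp add: tw_refl_def)
    then show ?thesis
      using js True assms(1) by (intro exI[of _ "i # js"]) auto
  next
    case False
    then have "tw_refl n i = weight_refl (2 * n) i \<circ> weight_refl (2 * n) (2 * n - i)"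
      by (simp add: tw_refl_def)
    then show ?thesis
      using js False Cons.prems by (intro exI[of _ "i # (2 * n - i) # js"]) auto
  qed
qed

lemma tw_fin_weyl_fixes:
  assumes "n \<ge> 2" "w \<in> tw_fin_weyl n"
  shows "w (fund_weight 0) = fund_weight 0"
proof -
  obtain ws where ws: "set ws \<subseteq> {1..n}" "w = foldr (tw_refl n) ws"
    using assms tw_weyl_eq by blast
  have "foldr (tw_refl n) ws (fund_weight 0) = fund_weight 0" using ws(1)
    by (induction ws) (auto simp: tw_refl_def weight_refl_def fund_weight_def)
  then show ?thesis using ws by simp
qed

text \<open>
  Induction on the size.  A nonempty self-conjugate core has removable nodes of some residue \<open>i\<close>, which
  may be taken to be at most \<open>n\<close>, and then it also has some of residue \<open>2n - i\<close>.  Removing both classes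
  is the action of one twisted generator and leaves a smaller self-conjugate core.
\<close>

lemma tw_weyl_reaches_core:
  assumes n: "n \<ge> 2" and "abacus_core (2 * n) c" "conjugate c = c"
  shows "\<exists>w\<in>tw_weyl n. w (fund_weight 0) = core_weight (2 * n) c"
  using assms(2,3)
proof (induction "card c" arbitrary: c rule: less_induct)
  case less
  define e where "e = 2 * n"
  have e: "e \<ge> 3" "e \<ge> 2" using n unfolding e_def by auto
  have c: "abacus_core e c" using less.prems unfolding e_def by simp
  then have p: "is_partition c" unfolding abacus_core_def by blast
  show ?case
  proof (cases "c = {}")
    case True
    have "id \<in> tw_weyl n" unfolding tw_weyl_def one_weight_perms[symmetric] by (rule generate.one)
    then show ?thesis using True core_weight_empty by (intro bexI[of _ id]) auto
  next
    case False
    then obtain r where r: "r < e" "removable_nodes e r c \<noteq> {}"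
      using ex_removable[OF p, of e] e by auto
    then have "removable_nodes e ((e - r) mod e) c \<noteq> {}"
      using removable_nodes_conjugate[OF less.prems(2) r(1)] by simp
    moreover have "(e - r) mod e = e - r \<and> e - r \<le> n" if "\<not> r \<le> n" using that r(1) unfolding e_def by auto
    ultimately obtain i where i: "i \<le> n" "removable_nodes e i c \<noteq> {}"
      using r(2) by metis
    then have ie: "i < e" using n unfolding e_def by simp
    have nonempty': "removable_nodes e ((e - i) mod e) c \<noteq> {}"
      using removable_nodes_conjugate[OF less.prems(2) ie] i by simp
    have "\<exists>d. abacus_core e d \<and> conjugate d = d \<and> card d < card c
      \<and> core_weight e c = tw_refl n i (core_weight e d)"
    proof (cases "i = 0 \<or> i = n")
      case True
      then have ii: "(e - i) mod e = i" using n unfolding e_def by auto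
      define d where "d = core_refl e i c"
      have "d = c - removable_nodes e i c - removable_nodes e ((e - i) mod e) c"
        unfolding d_def ii core_refl_def using i by auto
      then have "conjugate d = d" using conjugate_diff_removable[OF less.prems(2) ie] by simp
      moreover have "tw_refl n i (core_weight e d) = core_weight e c"
        unfolding d_def core_weight_core_refl[OF c e(1) ie]
        using True weight_refl_involution[OF ie] by (simp add: tw_refl_def e_def)
      ultimately show ?thesis
        using abacus_core_core_refl[OF c e(2)] card_core_refl_less[OF partition_finite[OF p] i(2)]
        unfolding d_def by metis
    next
      case False
      define j where "j = e - i"
      have j: "j < e" "(e - i) mod e = j" "i \<noteq> j" "cartan e j i = 0"
        using False i cartan_opposite[of i n] unfolding j_def e_def by auto
      have nonempty: "removable_nodes e j c \<noteq> {}" using nonempty' j by simp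
      define d where "d = core_refl e i c"
      define d' where "d' = core_refl e j d"
      have rem: "removable_nodes e j d = removable_nodes e j c"
        unfolding d_def by (rule far_removable_nodes[OF c e(1) ie j(1) j(3,4) i(2) nonempty])
      have d: "abacus_core e d" unfolding d_def by (rule abacus_core_core_refl[OF c e(2)])
      have d': "abacus_core e d'" unfolding d'_def by (rule abacus_core_core_refl[OF d e(2)])
      have "d' = c - removable_nodes e i c - removable_nodes e ((e - i) mod e) c"
        using nonempty i rem unfolding d'_def core_refl_def j by (simp add: d_def core_refl_def)
      then have conj: "conjugate d' = d'" using conjugate_diff_removable[OF less.prems(2) ie] by simp
      have "card d < card c"
        unfolding d_def by (rule card_core_refl_less[OF partition_finite[OF p] i(2)])
      moreover have "card d' < card d"
        unfolding d'_def using d nonempty rem partition_finite unfolding abacus_core_def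
        by (intro card_core_refl_less) auto
      ultimately have card: "card d' < card c" by simp
      have "core_weight e d = weight_refl e i (core_weight e c)"
        unfolding d_def by (rule core_weight_core_refl[OF c e(1) ie])
      moreover have "core_weight e d' = weight_refl e j (core_weight e d)"
        unfolding d'_def by (rule core_weight_core_refl[OF d e(1) j(1)])
      ultimately have "core_weight e c = weight_refl e i (weight_refl e j (core_weight e d'))"
        by (simp add: weight_refl_involution ie j(1))
      then have "core_weight e c = tw_refl n i (core_weight e d')"
        using False by (simp add: tw_refl_def e_def j_def)
      then show ?thesis using d' conj card by (intro exI[of _ d']) auto
    qed
    then obtain d where d: "abacus_core e d" "conjugate d = d" "card d < card c"
      "core_weight e c = tw_refl n i (core_weight e d)" by blast
    obtain w where w: "w \<in> tw_weyl n" "w (fund_weight 0) = core_weight e d"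
      using less.hyps[OF d(3)] d(1,2) unfolding e_def by blast
    obtain ws where ws: "set ws \<subseteq> {0..n}" "w = foldr (tw_refl n) ws"
      using w(1) tw_weyl_eq(1)[OF n] by blast
    have "foldr (tw_refl n) (i # ws) \<in> tw_weyl n"
      unfolding tw_weyl_eq(1)[OF n] using ws(1) i(1) by (intro CollectI exI[of _ "i # ws"]) auto
    moreover have "foldr (tw_refl n) (i # ws) (fund_weight 0) = core_weight e c"
      using ws(2) w(2) d(4) by simp
    ultimately show ?thesis unfolding e_def by blast
  qed
qed

text \<open>
  An element of minimal length in the coset of \<open>w\<close> will do, as the finite Weyl group fixes \<open>\<Lambda>\<^sub>0\<close>.
\<close>

lemma tw_grassmannian_rep:
  assumes n: "n \<ge> 2" and w: "w \<in> tw_weyl n"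
  shows "\<exists>v\<in>tw_grassmannian n. v (fund_weight 0) = w (fund_weight 0)"
proof -
  let ?H = "tw_fin_weyl n"
  have bij_tw: "bij v" if "v \<in> tw_weyl n" for v
    using that bij_foldr[of "{0..n}" "tw_refl n", OF tw_refl_involution[OF n]] unfolding tw_weyl_eq(1)[OF n] by fastforce
  have sub: "?H \<subseteq> tw_weyl n" unfolding tw_weyl_eq[OF n] by fastforce
  have mult: "g \<otimes>\<^bsub>weight_perms\<^esub> h = g \<circ> h" if "g \<in> tw_weyl n" "h \<in> tw_weyl n" for g h
    using that by (intro mult_weight_perms bij_tw)
  have coset: "v <#\<^bsub>weight_perms\<^esub> ?H = {v \<circ> h | h. h \<in> ?H}" if "v \<in> tw_weyl n" for v
  proof -
    have "v \<otimes>\<^bsub>weight_perms\<^esub> h = v \<circ> h" if "h \<in> ?H" for h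
      using mult[OF \<open>v \<in> tw_weyl n\<close>] that sub by blast
    then show ?thesis unfolding l_coset_def by auto
  qed
  have comp: "g \<circ> h \<in> ?H" if gh: "g \<in> ?H" "h \<in> ?H" for g h
  proof -
    have "g \<otimes>\<^bsub>weight_perms\<^esub> h \<in> ?H"
      using gh unfolding tw_fin_weyl_def by (rule generate.eng)
    then show ?thesis using mult gh sub by (simp add: subset_iff)
  qed
  have comp': "g \<circ> h \<in> tw_weyl n" if gh: "g \<in> tw_weyl n" "h \<in> tw_weyl n" for g h
  proof -
    have "g \<otimes>\<^bsub>weight_perms\<^esub> h \<in> tw_weyl n"
      using gh unfolding tw_weyl_def by (rule generate.eng)
    then show ?thesis using mult gh by simp
  qed
  have "id \<in> ?H" unfolding tw_fin_weyl_def one_weight_perms[symmetric] by (rule generate.one)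
  then have "w \<in> w <#\<^bsub>weight_perms\<^esub> ?H" unfolding coset[OF w] by (intro CollectI exI[of _ id]) simp
  then obtain v where v: "v \<in> w <#\<^bsub>weight_perms\<^esub> ?H"
    "\<And>u. u \<in> w <#\<^bsub>weight_perms\<^esub> ?H \<Longrightarrow> tw_length n v \<le> tw_length n u"
    using ex_has_least_nat[of "\<lambda>v. v \<in> w <#\<^bsub>weight_perms\<^esub> ?H" w "tw_length n"] by blast
  then obtain h where h: "h \<in> ?H" "v = w \<circ> h" unfolding coset[OF w] by blast
  have vt: "v \<in> tw_weyl n" unfolding h(2) using comp' w h(1) sub by blast
  have "u \<in> w <#\<^bsub>weight_perms\<^esub> ?H" if u: "u \<in> v <#\<^bsub>weight_perms\<^esub> ?H" for u
  proof -
    obtain h' where h': "h' \<in> ?H" "u = v \<circ> h'" using u unfolding coset[OF vt] by blast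
    have "u = w \<circ> (h \<circ> h')" unfolding h'(2) h(2) by (rule comp_assoc)
    then show ?thesis unfolding coset[OF w] using comp[OF h(1) h'(1)] by blast
  qed
  then have "v \<in> tw_grassmannian n" unfolding tw_grassmannian_def using vt v(2) by blast
  moreover have "v (fund_weight 0) = w (fund_weight 0)"
    using h tw_fin_weyl_fixes[OF n] by simp
  ultimately show ?thesis by blast
qed

lemma core_act_tw_weyl_iff:
  assumes n: "n \<ge> 2" and w: "w \<in> tw_weyl n" and c: "abacus_core (2 * n) c"
  shows "core_act (2 * n) w {} = c \<longleftrightarrow> w (fund_weight 0) = core_weight (2 * n) c"
proof -
  have e: "2 * n \<ge> 3" using n by simp
  obtain ws where ws: "set ws \<subseteq> {0..n}" "w = foldr (tw_refl n) ws"
    using w tw_weyl_eq(1)[OF n] by blast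
  obtain js where js: "set js \<subseteq> {..<2 * n}" "w = foldr (weight_refl (2 * n)) js"
    using tw_word_weight_word[OF n ws(1)] ws(2) by blast
  have "core_act (2 * n) w {} = foldr (core_refl (2 * n)) js {}"
    by (rule core_act_word[OF e js])
  moreover have "w (fund_weight 0) = core_weight (2 * n) (foldr (core_refl (2 * n)) js {})"
    unfolding js(2) by (rule word_weight(2)[OF e js(1), symmetric])
  ultimately show ?thesis
    using core_weight_inj[OF e word_weight(1)[OF e js(1)] c] by metis
qed

lemma grassmannian_of_weight:
  assumes n: "n \<ge> 2" and c: "c \<in> sc_cores (2 * n)"
  shows "grassmannian_of n c tw_weight0 = (\<lambda>k. 2 * core_weight (2 * n) c k)"
proof -
  have ac: "abacus_core (2 * n) c" and conj: "conjugate c = c"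
    using c n abacus_core_of_core[of c "2 * n"] unfolding sc_cores_def by auto
  obtain v where v: "v \<in> tw_grassmannian n" "v (fund_weight 0) = core_weight (2 * n) c"
    using tw_weyl_reaches_core[OF n ac conj] tw_grassmannian_rep[OF n] by metis
  have sub: "tw_grassmannian n \<subseteq> tw_weyl n" unfolding tw_grassmannian_def by blast
  have "core_act (2 * n) v {} = c"
    using core_act_tw_weyl_iff[OF n _ ac] v sub by blast
  then have im: "c \<in> (\<lambda>w. core_act (2 * n) w {}) ` tw_grassmannian n" using v(1) by blast
  define w where "w = grassmannian_of n c"
  have w: "w \<in> tw_weyl n" "core_act (2 * n) w {} = c"
    using inv_into_into[OF im] f_inv_into_f[OF im] sub unfolding w_def grassmannian_of_def by auto
  then have "w (fund_weight 0) = core_weight (2 * n) c"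
    using core_act_tw_weyl_iff[OF n _ ac] by blast
  moreover obtain ws where "set ws \<subseteq> {0..n}" "w = foldr (tw_refl n) ws"
    using w(1) tw_weyl_eq(1)[OF n] by blast
  moreover obtain js where "foldr (tw_refl n) ws = foldr (weight_refl (2 * n)) js"
    using tw_word_weight_word[OF n] calculation(2) by blast
  ultimately show ?thesis
    unfolding w_def[symmetric] tw_weight0_def by (simp add: foldr_weight_refl_scale)
qed

section \<open>Coefficients in the twisted simple roots\<close>

text \<open>
  The coefficients in \<open>\<alpha>\<^sub>0, \<dots>, \<alpha>\<^sub>2\<^sub>n\<^sub>-\<^sub>1\<close> of a combination of the twisted simple roots.
\<close>

definition unfold_coeff :: "nat \<Rightarrow> (nat \<Rightarrow> real) \<Rightarrow> nat \<Rightarrow> real" where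
  "unfold_coeff n a j = (if j = 0 then 2 * a 0 else if j \<le> n then a j else a (2 * n - j))"

lemma sum_residues_split:
  fixes f :: "nat \<Rightarrow> real"
  assumes "n \<ge> 1"
  shows "(\<Sum>j<2 * n. f j) = f 0 + (\<Sum>j\<in>{1..<n}. f j + f (2 * n - j)) + f n"
proof -
  have "{..<2 * n} = insert 0 (insert n ({1..<n} \<union> {n<..<2 * n}))" using assms by auto
  moreover have "{1..<n} \<inter> {n<..<2 * n} = {}" by auto
  then have "sum f ({1..<n} \<union> {n<..<2 * n}) = sum f {1..<n} + sum f {n<..<2 * n}"
    by (intro sum.union_disjoint) auto
  ultimately have "(\<Sum>j<2 * n. f j) = f 0 + (f n + (sum f {1..<n} + sum f {n<..<2 * n}))"
    using assms by simp
  also have "sum f {n<..<2 * n} = (\<Sum>j\<in>{1..<n}. f (2 * n - j))"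
    by (rule sum.reindex_bij_witness[where i = "\<lambda>j. 2 * n - j" and j = "\<lambda>j. 2 * n - j"]) auto
  finally show ?thesis by (simp add: sum.distrib)
qed

lemma sum_ends_split:
  fixes f :: "nat \<Rightarrow> real"
  assumes "n \<ge> 1"
  shows "(\<Sum>j=0..n. f j) = f 0 + (\<Sum>j\<in>{1..<n}. f j) + f n"
proof -
  have "{0..n} = insert 0 (insert n {1..<n})" using assms by auto
  then show ?thesis using assms by simp
qed

lemma sum_tw_root:
  assumes "n \<ge> 1"
  shows "(\<Sum>i=0..n. a i * tw_root n i k)
    = (\<Sum>j<2 * n. unfold_coeff n a j * simple_root (2 * n) j k)"
  unfolding sum_residues_split[OF assms] sum_ends_split[OF assms]
  using assms by (auto simp: tw_root_def unfold_coeff_def algebra_simps intro!: sum.cong)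

text \<open>
  The scaling element sees only \<open>\<alpha>\<^sub>0\<close>, so its coefficient vanishes.  By symmetry both neighbours of the
  vertex 0 have the same coefficient, which the coroot at 0 makes zero.  Each further coroot then gives
  the next coefficient.
\<close>

lemma tw_root_independent:
  assumes n: "n \<ge> 2" and zero: "\<And>k. (\<Sum>i=0..n. a i * tw_root n i k) = 0" and "i \<le> n"
  shows "a i = 0"
proof -
  define b where "b = unfold_coeff n a"
  have e: "2 * n \<ge> 3" using n by simp
  have b: "(\<Sum>j<2 * n. b j * simple_root (2 * n) j k) = 0" for k
    using zero[of k] sum_tw_root[of n a k] n unfolding b_def by simp
  have b0: "b 0 = 0" using b[of "2 * n"] unfolding sum_simple_root[OF e] by simp
  have "b (Suc 0) + b (2 * n - 1) = 0"
    using b[of 0] b0 n unfolding sum_simple_root[OF e] by simp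
  moreover have "b (2 * n - 1) = b (Suc 0)" using n unfolding b_def unfold_coeff_def by auto
  ultimately have b1: "b (Suc 0) = 0" by simp
  have "Suc m \<le> n \<Longrightarrow> b m = 0 \<and> b (Suc m) = 0" for m
  proof (induction m)
    case (Suc m)
    have "(Suc m + 2 * n - 1) mod (2 * n) = m" "(Suc m + 1) mod (2 * n) = Suc (Suc m)"
      using Suc.prems n by auto
    then have "2 * b (Suc m) - b (Suc (Suc m)) - b m = 0"
      using b[of "Suc m"] Suc.prems n unfolding sum_simple_root[OF e] by simp
    then show ?case using Suc by simp
  qed (use b0 b1 in simp)
  then have "b i = 0" using b0 assms(3) by (cases i) auto
  then show ?thesis using assms(3) unfolding b_def unfold_coeff_def by (auto split: if_splits)
qed

lemma card_eq_sum_residue_count: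
  assumes "finite c" "e > 0"
  shows "card c = (\<Sum>j<e. residue_count e j c)"
proof -
  have "c = (\<Union>j<e. {b \<in> c. box_residue e b = j})" using box_residue_less[OF assms(2)] by blast
  moreover have "card (\<Union>j<e. {b \<in> c. box_residue e b = j}) = (\<Sum>j<e. residue_count e j c)"
    unfolding residue_count_def using assms(1) by (intro card_UN_disjoint) auto
  ultimately show ?thesis by metis
qed

text \<open>
  The weight formula, doubled, gives every \<open>\<alpha>\<^sub>j\<close> the coefficient \<open>2 a\<^sub>j\<close>.  At 0 the factor 2 is absorbed by
  the twisted root \<open>2 \<alpha>\<^sub>0\<close>.
\<close>

lemma tw_coeff_sc_core:
  assumes n: "n \<ge> 2" and c: "c \<in> sc_cores (2 * n)"
  shows "tw_coeff n c = (\<lambda>i. if i = 0 then real (residue_count (2 * n) 0 c)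
    else if i \<le> n then 2 * real (residue_count (2 * n) i c) else 0)" (is "_ = ?a")
proof -
  have conj: "conjugate c = c" using c unfolding sc_cores_def by blast
  have unf: "unfold_coeff n ?a j = 2 * real (residue_count (2 * n) j c)" if "j < 2 * n" for j
    using that residue_count_conjugate[OF conj, of j "2 * n"] by (auto simp: unfold_coeff_def)
  have ex: "tw_weight0 k - grassmannian_of n c tw_weight0 k = (\<Sum>i=0..n. ?a i * tw_root n i k)" for k
  proof -
    have "(\<Sum>i=0..n. ?a i * tw_root n i k)
        = (\<Sum>j<2 * n. 2 * real (residue_count (2 * n) j c) * simple_root (2 * n) j k)"
      using sum_tw_root[of n ?a k] n unf by (simp cong: sum.cong_simp)
    then show ?thesis
      unfolding grassmannian_of_weight[OF n c]
      by (simp add: tw_weight0_def core_weight_def sum_distrib_left algebra_simps)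
  qed
  show ?thesis
    unfolding tw_coeff_def
  proof (rule the_equality)
    show "(\<forall>i>n. ?a i = 0) \<and>
      (\<forall>k. tw_weight0 k - grassmannian_of n c tw_weight0 k = (\<Sum>i=0..n. ?a i * tw_root n i k))"
      using ex by simp
  next
    fix a assume a: "(\<forall>i>n. a i = 0) \<and>
      (\<forall>k. tw_weight0 k - grassmannian_of n c tw_weight0 k = (\<Sum>i=0..n. a i * tw_root n i k))"
    have "(\<Sum>i=0..n. (a i - ?a i) * tw_root n i k) = 0" for k
      using a ex[of k] by (simp only: left_diff_distrib sum_subtractf)
    from tw_root_independent[OF n this] have "a i = ?a i" if "i \<le> n" for i using that by simp
    then show "a = ?a" using a by (intro ext) (metis (no_types, lifting) not_le not_less_zero)
  qed
qed

theorem proposition5p7: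
  fixes n :: nat and c :: "box set"
  assumes "n \<ge> 2"
    and "c \<in> sc_cores (2 * n)"
  shows "atomic_length n c = real (card c) + real (residue_count (2 * n) n c)"
proof -
  define r where "r j = real (residue_count (2 * n) j c)" for j
  have n1: "n \<ge> 1" using assms(1) by simp
  have conj: "conjugate c = c" and fin: "finite c"
    using assms(2) partition_finite unfolding sc_cores_def cores_def by auto
  have "real (card c) = (\<Sum>j<2 * n. r j)"
    using card_eq_sum_residue_count[OF fin, of "2 * n"] n1 unfolding r_def by simp
  also have "\<dots> = r 0 + (\<Sum>j\<in>{1..<n}. r j + r (2 * n - j)) + r n"
    by (rule sum_residues_split[OF n1])
  also have "(\<Sum>j\<in>{1..<n}. r j + r (2 * n - j)) = (\<Sum>j\<in>{1..<n}. 2 * r j)"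
  proof (rule sum.cong)
    fix j assume "j \<in> {1..<n}"
    then show "r j + r (2 * n - j) = 2 * r j"
      using residue_count_conjugate[OF conj, of j "2 * n"] unfolding r_def by simp
  qed simp
  finally have card: "real (card c) = r 0 + (\<Sum>j\<in>{1..<n}. 2 * r j) + r n" .
  have "atomic_length n c = r 0 + (\<Sum>j\<in>{1..<n}. 2 * r j) + 2 * r n"
    unfolding atomic_length_def tw_coeff_sc_core[OF assms] sum_ends_split[OF n1] r_def
    using n1 by (auto intro!: sum.cong)
  then show ?thesis using card unfolding r_def by simp
qed

end
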